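(* Fix some $\beta>1$, and let $\gamma>0$, $L>0$. There are $\varepsilon>0$ and $x>0$ such that $$\liminf_{n\to\infty}\inf_{p_n}\sup_{p_T\in\mathcal{C}(\beta,\gamma,L)}\mathrm{P}^{\otimes n}_{p_T}\Bigl(|p_T(x)-p_n(x)|\ge\varepsilon\,n^{-\frac{\beta}{\pi+2\beta}}\log^{-\rho}(n)\Bigr)>0,$$ $$\liminf_{n\to\infty}\inf_{p_n}\sup_{p_T\in\mathcal{D}(\beta,\gamma,L)}\mathrm{P}^{\otimes n}_{p_T}\Bigl(|p_T(x)-p_n(x)|\ge\varepsilon\log^{-\beta}(n)\Bigr)>0,$$ for some $\rho>0$, where the infimum is taken over all estimators $p_n$ (i.e. all measurable functions of $X_1,\dots,X_n$) of $p_T$, and $\mathrm{P}^{\otimes n}_{p_T}$ is the distribution of the i.i.d. sample $X_1,\dots,X_n$ with $X_1\sim W_T$ and $T\sim p_T$.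
   Context: $W$ is a standard Brownian motion and $T\ge0$ is a random time independent of $W$ with density $p_T$ on $\mathbb{R}_+$; the suprema are over probability densities $p_T$ in the indicated classes. The Mellin transform is $\mathcal{M}[f](z)=\int_0^\infty f(x)x^{z-1}\,dx$, and for $\beta,\gamma,L>0$ $$\mathcal{C}(\beta,\gamma,L)=\Bigl\{f:\int_{-\infty}^\infty|\mathcal{M}[f](\gamma+\mathrm{i}v)|\,e^{\beta|v|}\,dv<L\Bigr\},$$ $$\mathcal{D}(\beta,\gamma,L)=\Bigl\{f:\int_{-\infty}^\infty|\mathcal{M}[f](\gamma+\mathrm{i}v)|\,(1+|v|^{\beta})\,dv<L\Bigr\}.$$ *)

theory Defs
  imports "HOL-Probability.Probability"
begin

text \<open>Only the values of \<^term>\<open>W t\<close> at times \<open>t \<ge> 0\<close> are meaningful. Paths are continuous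
  surely, not just almost surely, so that \<open>(\<omega>, t) \<mapsto> W t \<omega>\<close> is jointly measurable on
  \<open>space M \<times> {0..}\<close> without completing \<^term>\<open>M\<close>.\<close>

locale standard_brownian_motion = prob_space M for M :: "'a measure" +
  fixes W :: "real \<Rightarrow> 'a \<Rightarrow> real"
  assumes measurable_at: "0 \<le> t \<Longrightarrow> W t \<in> borel_measurable M"
    and start: "AE \<omega> in M. W 0 \<omega> = 0"
    and indep_increments:
      "0 \<le> \<tau> 0 \<Longrightarrow> (\<And>i. i < k \<Longrightarrow> \<tau> i \<le> \<tau> (Suc i)) \<Longrightarrow>
        indep_vars (\<lambda>_. borel) (\<lambda>i \<omega>. W (\<tau> (Suc i)) \<omega> - W (\<tau> i) \<omega>) {..<k}"
    and normal_increments: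
      "0 \<le> r \<Longrightarrow> r < s \<Longrightarrow>
        distributed M lborel (\<lambda>\<omega>. W s \<omega> - W r \<omega>)
          (\<lambda>y. ennreal (normal_density 0 (sqrt (s - r)) y))"
    and continuous_paths: "\<omega> \<in> space M \<Longrightarrow> continuous_on {0..} (\<lambda>t. W t \<omega>)"

definition time_law :: "(real \<Rightarrow> real) \<Rightarrow> real measure" where
  "time_law p = density (restrict_space lborel {0..}) (\<lambda>t. ennreal (p t))"

text \<open>A point value \<open>p x\<close> of a density is only meaningful for a fixed version. A density with
  absolutely integrable Mellin transform on a vertical line agrees almost everywhere, by Mellin
  inversion, with exactly one function that is continuous on \<open>{0<..}\<close>; this is the version meant.
  Without continuity, changing a density at the single point \<open>x\<close> would make pointwise lower
  bounds trivial.\<close>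

definition time_densities :: "(real \<Rightarrow> real) set" where
  "time_densities =
    {p. p \<in> borel_measurable (restrict_space lborel {0..}) \<and> (\<forall>t\<ge>0. 0 \<le> p t) \<and>
        prob_space (time_law p) \<and> continuous_on {0<..} p}"

text \<open>The law of \<open>W\<^sub>T\<close> for \<open>T\<close> with density \<^term>\<open>p\<close> independent of \<^term>\<open>W\<close>: independence is
  realised by the product space.\<close>

definition stopped_law ::
    "'a measure \<Rightarrow> (real \<Rightarrow> 'a \<Rightarrow> real) \<Rightarrow> (real \<Rightarrow> real) \<Rightarrow> real measure" where
  "stopped_law M W p = distr (M \<Otimes>\<^sub>M time_law p) borel (\<lambda>(\<omega>, t). W t \<omega>)"

definition sample_law ::
    "'a measure \<Rightarrow> (real \<Rightarrow> 'a \<Rightarrow> real) \<Rightarrow> nat \<Rightarrow> (real \<Rightarrow> real) \<Rightarrow> (nat \<Rightarrow> real) measure" where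
  "sample_law M W n p = (\<Pi>\<^sub>M i\<in>{1..n}. stopped_law M W p)"

text \<open>An estimator maps the sample \<open>X\<^sub>1, \<dots>, X\<^sub>n\<close> to a function on the line; its value at each
  point is a measurable function of the sample.\<close>

definition estimators :: "nat \<Rightarrow> ((nat \<Rightarrow> real) \<Rightarrow> real \<Rightarrow> real) set" where
  "estimators n = {q. \<forall>y. (\<lambda>X. q X y) \<in> borel_measurable (\<Pi>\<^sub>M i\<in>{1..n}. borel)}"

definition mellin_integrand :: "(real \<Rightarrow> real) \<Rightarrow> complex \<Rightarrow> real \<Rightarrow> complex" where
  "mellin_integrand f z x = complex_of_real (f x) * complex_of_real x powr (z - 1)"

definition mellin :: "(real \<Rightarrow> real) \<Rightarrow> complex \<Rightarrow> complex" where
  "mellin f z = (LINT x:{0<..}|lborel. mellin_integrand f z x)"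

text \<open>Integrability on the line \<open>Re z = \<gamma>\<close> is required explicitly, because \<^const>\<open>mellin\<close> is
  \<open>0\<close> where the integral does not exist.\<close>

definition mellin_exists_on_line :: "(real \<Rightarrow> real) \<Rightarrow> real \<Rightarrow> bool" where
  "mellin_exists_on_line f \<gamma> \<longleftrightarrow>
    (\<forall>v. set_integrable lborel {0<..} (mellin_integrand f (Complex \<gamma> v)))"

definition mellin_class_C :: "real \<Rightarrow> real \<Rightarrow> real \<Rightarrow> (real \<Rightarrow> real) set" where
  "mellin_class_C \<beta> \<gamma> L =
    {f. mellin_exists_on_line f \<gamma> \<and>
        (\<integral>\<^sup>+ v. ennreal (cmod (mellin f (Complex \<gamma> v)) * exp (\<beta> * \<bar>v\<bar>)) \<partial>lborel) < ennreal L}"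

definition mellin_class_D :: "real \<Rightarrow> real \<Rightarrow> real \<Rightarrow> (real \<Rightarrow> real) set" where
  "mellin_class_D \<beta> \<gamma> L =
    {f. mellin_exists_on_line f \<gamma> \<and>
        (\<integral>\<^sup>+ v. ennreal (cmod (mellin f (Complex \<gamma> v)) * (1 + \<bar>v\<bar> powr \<beta>)) \<partial>lborel) < ennreal L}"

end

theory Submission
  imports Defs "HOL-Complex_Analysis.Complex_Analysis" "HOL-Real_Asymp.Real_Asymp"
begin

text \<open>
  The bounds follow from Le Cam's two-point method. For each large \<open>n\<close> there are two densities in
  the class that differ at a fixed point \<open>x\<close> by the claimed rate, while the corresponding laws of
  \<open>W\<^sub>T\<close> are so close that \<open>n\<close> observations cannot tell them apart. An estimator then misses one
  of the two densities with probability at least \<open>1/8\<close> (\<open>two_point_testing\<close>, \<open>two_point_minimax\<close>).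

  With \<open>T = exp U\<close> everything is expressed through the density \<open>b\<close> of \<open>U\<close>: the Mellin transform of
  the density of \<open>T\<close> on the line \<open>Re z = \<gamma>\<close> is the Fourier transform of \<open>b u * exp ((\<gamma> - 1) * u)\<close>,
  and \<open>W\<^sub>T\<close> is a mixture of centred normal laws of variance \<open>exp u\<close>. The unperturbed \<open>b\<close> is
  Gaussian up to a small second component, and the perturbation is \<open>\<delta>\<close> times a Gaussian times
  \<open>sin (V * (u - \<mu>))\<close>. It moves mass \<open>\<delta>\<close> of the Mellin transform to the frequencies \<open>\<plusminus>V\<close>, which
  costs \<open>\<delta> * exp (\<beta> * V)\<close> in the first class and \<open>\<delta> * (1 + V) powr \<beta>\<close> in the second
  (\<open>nn_integral_mellin_oscillating_hypothesis\<close>). Hence \<open>\<delta>\<close> may be of order \<open>exp (- \<beta> * V)\<close> or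
  \<open>V powr (- \<beta>)\<close>, and \<open>\<delta>\<close> is also the order of the difference at \<open>x\<close>.

  Observing only \<open>W\<^sub>T\<close> damps the oscillation by \<open>exp (- pi * V / 2)\<close>. This is Cauchy's theorem: the
  integrand of the mixture is entire in \<open>u\<close>, and shifting the line of integration upwards by \<open>\<theta>\<close>
  multiplies \<open>exp (\<i> * V * u)\<close> by \<open>exp (- V * \<theta>)\<close>, whereas the normal kernel
  \<open>exp (- (y\<^sup>2 / 2) * exp (- u))\<close> stays bounded as long as \<open>\<theta> \<le> pi / 2\<close>. To keep decay in \<open>y\<close> one
  stops at \<open>\<theta> = arctan V\<close>. The shifted kernel is then the normal kernel at \<open>u + a\<close> with
  \<open>exp (- a) = cos \<theta>\<close>, so the perturbation of the density of \<open>W\<^sub>T\<close> is dominated pointwise by the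
  density that comes from the Gaussian moved by \<open>a\<close> (\<open>oscillating_mixture_bound\<close>). That moved
  Gaussian is the second component of the unperturbed \<open>b\<close>; its weight \<open>exp (- a * \<gamma>) / 2\<close> keeps the
  Mellin transform under control and costs only a power of \<open>V\<close>. The likelihood ratio therefore
  differs from \<open>1\<close> by at most a multiple of \<open>\<delta> * V powr (\<gamma> + 1/2) * exp (- pi * V / 2)\<close>
  (\<open>minimax_at_frequency\<close>).

  It remains to make the square of this bound at most \<open>1/n\<close>. In the first class this forces
  \<open>exp (- (pi + 2 * \<beta>) * V)\<close> to be about \<open>1/n\<close> up to powers of \<open>ln n\<close>, whence
  \<open>\<delta>\<close> is about \<open>n powr (- \<beta> / (pi + 2 * \<beta>))\<close>. In the second class \<open>V\<close> of order \<open>ln n\<close> suffices,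
  whence \<open>\<delta>\<close> is about \<open>ln n powr (- \<beta>)\<close>.
\<close>

section \<open>The substitution t = exp u\<close>

text \<open>If \<open>U\<close> has density \<open>b\<close>, then \<open>exp U\<close> has this density on \<open>{0<..}\<close>.\<close>

definition exp_density :: "(real \<Rightarrow> real) \<Rightarrow> real \<Rightarrow> real" where
  "exp_density b t = b (ln t) / t"

lemma exp_density_exp [simp]: "exp_density b (exp u) = b u / exp u"
  by (simp add: exp_density_def)

lemma measurable_exp_density [measurable]:
  "b \<in> borel_measurable borel \<Longrightarrow> exp_density b \<in> borel_measurable borel"
  unfolding exp_density_def[abs_def]
  by (intro borel_measurable_divide measurable_compose[OF borel_measurable_ln]) auto

text \<open>Both changes of variables below, for nonnegative and for complex integrands, are instances of this
identity of measures. On the compact intervals \<open>{- k..k}\<close> it is the substitution rule; continuity of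
measures from below removes the restriction.\<close>

lemma distr_exp_lborel:
  "distr (density lborel (\<lambda>u. ennreal (exp u))) lborel exp
     = density lborel (indicator {0<..})" (is "?L = ?R")
proof (rule measure_eqI)
  fix A :: "real set" assume "A \<in> sets ?L"
  then have A[measurable]: "A \<in> sets borel" by simp
  define I :: "nat \<Rightarrow> real set" where "I k = {- real k..real k}" for k
  define J :: "nat \<Rightarrow> real set" where "J k = {exp (- real k)..exp (real k)}" for k
  have [measurable]: "I k \<in> sets borel" "J k \<in> sets borel" for k
    by (auto simp: I_def J_def)
  have step: "(\<integral>\<^sup>+u. ennreal (indicator A (exp u) * exp u * indicator (I k) u) \<partial>lborel)
     = (\<integral>\<^sup>+t. ennreal (indicator A t * indicator (J k) t) \<partial>lborel)" for k
    unfolding I_def J_def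
    by (rule nn_integral_substitution[where f = "indicator A" and g = exp and g' = exp, symmetric])
      (auto intro!: derivative_eq_intros continuous_intros simp: set_borel_measurable_def)
  have UI: "(\<Union>k. I k) = UNIV"
  proof -
    have "u \<in> (\<Union>k. I k)" for u :: real
    proof -
      obtain k where "\<bar>u\<bar> \<le> real k" using real_arch_simple by blast
      then show ?thesis by (intro UN_I[of k]) (auto simp: I_def)
    qed
    then show ?thesis by blast
  qed
  have UJ: "(\<Union>k. J k) = {0<..}"
  proof (intro set_eqI iffI)
    fix t :: real assume "t \<in> (\<Union>k. J k)"
    then obtain k where "t \<in> J k" by blast
    then show "t \<in> {0<..}"
      unfolding J_def using less_le_trans[OF exp_gt_zero] by auto
  next
    fix t :: real assume t: "t \<in> {0<..}"
    obtain k where "\<bar>ln t\<bar> \<le> real k" using real_arch_simple by blast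
    then have "- real k \<le> ln t" "ln t \<le> real k" by auto
    then have "exp (- real k) \<le> exp (ln t)" "exp (ln t) \<le> exp (real k)"
      unfolding exp_le_cancel_iff .
    moreover have "exp (ln t) = t" using t by simp
    ultimately have "exp (- real k) \<le> t" "t \<le> exp (real k)" by metis+
    then show "t \<in> (\<Union>k. J k)" using t by (auto simp: J_def intro!: exI[of _ k])
  qed
  have incI: "incseq I" "incseq J"
    by (auto simp: incseq_def I_def J_def intro: order_trans[rotated] order_trans)
  let ?D = "density lborel (\<lambda>u. ennreal (exp u))"
  have D: "emeasure ?D (exp -` A \<inter> I k) = emeasure lborel (A \<inter> J k)" for k
  proof -
    have "emeasure ?D (exp -` A \<inter> I k)
        = (\<integral>\<^sup>+u. ennreal (indicator A (exp u) * exp u * indicator (I k) u) \<partial>lborel)"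
      by (subst emeasure_density) (auto intro!: nn_integral_cong simp: indicator_def)
    also have "\<dots> = (\<integral>\<^sup>+t. indicator (A \<inter> J k) t \<partial>lborel)"
      unfolding step by (auto intro!: nn_integral_cong simp: indicator_def)
    finally show ?thesis by simp
  qed
  have "emeasure ?L A = emeasure ?D (\<Union>k. exp -` A \<inter> I k)"
    using UI by (subst emeasure_distr) (auto simp flip: Int_UN_distrib)
  also have "\<dots> = (SUP k. emeasure ?D (exp -` A \<inter> I k))"
    using incI by (intro SUP_emeasure_incseq[symmetric]) (auto simp: incseq_def)
  also have "\<dots> = (SUP k. emeasure lborel (A \<inter> J k))"
    by (simp only: D)
  also have "\<dots> = emeasure lborel (\<Union>k. A \<inter> J k)"
  proof (intro SUP_emeasure_incseq)
    show "incseq (\<lambda>k. A \<inter> J k)" using incI(2) unfolding incseq_def by blast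
  qed auto
  also have "(\<Union>k. A \<inter> J k) = {0<..} \<inter> A" using UJ by blast
  also have "emeasure lborel ({0<..} \<inter> A) = emeasure ?R A"
    by (simp add: emeasure_density flip: indicator_inter_arith)
  finally show "emeasure ?L A = emeasure ?R A" .
qed simp

lemma nn_integral_exp_subst:
  assumes [measurable]: "F \<in> borel_measurable borel"
  shows "(\<integral>\<^sup>+t. indicator {0<..} t * F t \<partial>lborel) = (\<integral>\<^sup>+u. ennreal (exp u) * F (exp u) \<partial>lborel)"
proof -
  have "(\<integral>\<^sup>+t. indicator {0<..} t * F t \<partial>lborel) = (\<integral>\<^sup>+t. F t \<partial>density lborel (indicator {0<..}))"
    by (subst nn_integral_density) auto
  also have "\<dots> = (\<integral>\<^sup>+u. ennreal (exp u) * F (exp u) \<partial>lborel)"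
    by (simp flip: distr_exp_lborel add: nn_integral_distr nn_integral_density)
  finally show ?thesis .
qed

lemma set_integral_exp_subst:
  fixes f :: "real \<Rightarrow> complex"
  assumes [measurable]: "f \<in> borel_measurable borel"
  shows "set_integrable lborel {0<..} f \<longleftrightarrow> integrable lborel (\<lambda>u. exp u *\<^sub>R f (exp u))"
    and "(LINT t:{0<..}|lborel. f t) = (\<integral>u. exp u *\<^sub>R f (exp u) \<partial>lborel)"
proof -
  have E: "density lborel (\<lambda>t. ennreal (indicator {0<..} t)) = distr (density lborel (\<lambda>u. ennreal (exp u))) lborel exp"
    by (simp add: distr_exp_lborel ennreal_indicator)
  have "set_integrable lborel {0<..} f \<longleftrightarrow> integrable (density lborel (\<lambda>t. ennreal (indicator {0<..} t))) f"
    unfolding set_integrable_def by (subst integrable_density) auto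
  also have "\<dots> \<longleftrightarrow> integrable lborel (\<lambda>u. exp u *\<^sub>R f (exp u))"
    unfolding E by (subst integrable_distr_eq) (auto simp: integrable_density)
  finally show "set_integrable lborel {0<..} f \<longleftrightarrow> integrable lborel (\<lambda>u. exp u *\<^sub>R f (exp u))" .
  have "(LINT t:{0<..}|lborel. f t) = (\<integral>t. f t \<partial>density lborel (\<lambda>t. ennreal (indicator {0<..} t)))"
    unfolding set_lebesgue_integral_def by (subst integral_density) auto
  also have "\<dots> = (\<integral>u. exp u *\<^sub>R f (exp u) \<partial>lborel)"
    unfolding E by (subst integral_distr) (auto simp: integral_density)
  finally show "(LINT t:{0<..}|lborel. f t) = (\<integral>u. exp u *\<^sub>R f (exp u) \<partial>lborel)" .
qed

lemma measurable_mellin_integrand [measurable]: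
  assumes [measurable]: "f \<in> borel_measurable borel"
  shows "mellin_integrand f z \<in> borel_measurable borel"
  unfolding mellin_integrand_def[abs_def] powr_def of_real_eq_0_iff by measurable

text \<open>On the line \<open>Re z = \<gamma>\<close> the factor \<open>t powr (z - 1)\<close> becomes \<open>exp ((\<gamma> - 1) * u) * exp (\<i> * v * u)\<close>, so
the Mellin transform turns into the Fourier transform of a tilted density.\<close>

lemma mellin_exp_density:
  assumes b[measurable]: "b \<in> borel_measurable borel"
    and int: "integrable lborel (\<lambda>u. b u * exp ((\<gamma> - 1) * u))"
  shows "mellin_exists_on_line (exp_density b) \<gamma>"
    and "mellin (exp_density b) (Complex \<gamma> v)
      = (\<integral>u. complex_of_real (b u * exp ((\<gamma> - 1) * u)) * iexp (v * u) \<partial>lborel)"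
proof -
  have eq: "exp u *\<^sub>R mellin_integrand (exp_density b) (Complex \<gamma> v) (exp u)
      = complex_of_real (b u * exp ((\<gamma> - 1) * u)) * iexp (v * u)" for u v
  proof -
    have "complex_of_real (exp u) powr (Complex \<gamma> v - 1) = exp ((Complex \<gamma> v - 1) * of_real u)"
      by (simp add: powr_def Ln_of_real)
    also have "(Complex \<gamma> v - 1) * of_real u = of_real ((\<gamma> - 1) * u) + \<i> * of_real (v * u)"
      by (simp add: complex_eq_iff)
    also have "exp \<dots> = of_real (exp ((\<gamma> - 1) * u)) * iexp (v * u)"
      by (simp only: exp_add exp_of_real)
    finally show ?thesis
      by (simp add: mellin_integrand_def scaleR_conv_of_real)
  qed
  have "integrable lborel (\<lambda>u. complex_of_real (b u * exp ((\<gamma> - 1) * u)) * iexp (v * u))" for v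
    by (rule Bochner_Integration.integrable_bound[OF int]) (auto simp: norm_mult)
  then show "mellin_exists_on_line (exp_density b) \<gamma>"
    unfolding mellin_exists_on_line_def by (subst set_integral_exp_subst) (simp_all add: eq)
  show "mellin (exp_density b) (Complex \<gamma> v)
      = (\<integral>u. complex_of_real (b u * exp ((\<gamma> - 1) * u)) * iexp (v * u) \<partial>lborel)"
    unfolding mellin_def
    by (subst set_integral_exp_subst(2)) (simp_all only: eq measurable_mellin_integrand measurable_exp_density b)
qed

lemma sets_time_law [measurable_cong]: "sets (time_law p) = sets (restrict_space borel {0..})"
  by (simp add: time_law_def cong: sets_restrict_space_cong)

lemma space_time_law [simp]: "space (time_law p) = {0..}"
  by (simp add: time_law_def space_restrict_space)

lemma nn_integral_time_law_exp_density:
  assumes b[measurable]: "b \<in> borel_measurable borel" and nonneg: "\<And>u. 0 \<le> b u"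
    and F: "F \<in> borel_measurable (restrict_space borel {0..})"
  shows "(\<integral>\<^sup>+t. F t \<partial>time_law (exp_density b)) = (\<integral>\<^sup>+u. ennreal (b u) * F (exp u) \<partial>lborel)"
proof -
  define G where "G t = (if t \<in> {0..} then F t else 0)" for t :: real
  have G[measurable]: "G \<in> borel_measurable borel"
  proof -
    have "G = (\<lambda>t. F t * indicator {0..} t)" by (auto simp: G_def fun_eq_iff indicator_def)
    then show ?thesis
      using F by (subst (asm) borel_measurable_restrict_space_iff_ennreal) auto
  qed
  have "(\<integral>\<^sup>+t. F t \<partial>time_law (exp_density b))
      = (\<integral>\<^sup>+t. ennreal (exp_density b t) * F t \<partial>restrict_space lborel {0..})"
    unfolding time_law_def
  proof (rule nn_integral_density)
    show "(\<lambda>t. ennreal (exp_density b t)) \<in> borel_measurable (restrict_space lborel {0..})"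
      by (intro measurable_restrict_space1) simp
    show "F \<in> borel_measurable (restrict_space lborel {0..})"
      using F by (simp cong: measurable_cong_sets sets_restrict_space_cong)
  qed
  also have "\<dots> = (\<integral>\<^sup>+t. ennreal (exp_density b t) * F t * indicator {0..} t \<partial>lborel)"
    by (simp add: nn_integral_restrict_space)
  also have "\<dots> = (\<integral>\<^sup>+t. indicator {0<..} t * (ennreal (exp_density b t) * G t) \<partial>lborel)"
    by (intro nn_integral_cong) (auto simp: G_def indicator_def exp_density_def)
  also have "\<dots> = (\<integral>\<^sup>+u. ennreal (exp u) * (ennreal (exp_density b (exp u)) * G (exp u)) \<partial>lborel)"
    by (rule nn_integral_exp_subst) measurable
  also have "\<dots> = (\<integral>\<^sup>+u. ennreal (b u) * F (exp u) \<partial>lborel)"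
    by (intro nn_integral_cong)
      (auto simp: G_def nonneg simp flip: mult.assoc ennreal_mult intro!: arg_cong2[where f = "(*)"])
  finally show ?thesis .
qed

lemma exp_density_in_time_densities:
  assumes cont: "continuous_on UNIV b" and nonneg: "\<And>u. 0 \<le> b u"
    and int: "integrable lborel b" "(\<integral>u. b u \<partial>lborel) = 1"
  shows "exp_density b \<in> time_densities"
proof -
  have b[measurable]: "b \<in> borel_measurable borel"
    using cont by (rule borel_measurable_continuous_onI)
  have "emeasure (time_law (exp_density b)) (space (time_law (exp_density b)))
      = (\<integral>\<^sup>+t. 1 \<partial>time_law (exp_density b))" by simp
  also have "\<dots> = (\<integral>\<^sup>+u. ennreal (b u) \<partial>lborel)"
    by (subst nn_integral_time_law_exp_density) (auto simp: nonneg)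
  also have "\<dots> = 1" using int nonneg by (simp add: nn_integral_eq_integral)
  finally have "prob_space (time_law (exp_density b))" by (rule prob_spaceI)
  moreover have "continuous_on {0<..} (exp_density b)"
    unfolding exp_density_def[abs_def]
    by (intro continuous_intros continuous_on_compose2[OF cont]) auto
  moreover have "exp_density b \<in> borel_measurable (restrict_space lborel {0..})"
    by (intro measurable_restrict_space1) simp
  moreover have "\<forall>t\<ge>0. 0 \<le> exp_density b t" by (simp add: exp_density_def nonneg)
  ultimately show ?thesis by (simp add: time_densities_def)
qed

section \<open>Shifting the line of integration\<close>

lemma integral_lborel_interval_tendsto:
  fixes f :: "real \<Rightarrow> complex"
  assumes "integrable lborel f"
  shows "((\<lambda>k. \<integral>u. indicator {- real k..real k} u *\<^sub>R f u \<partial>lborel)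
     \<longlonglongrightarrow> (\<integral>u. f u \<partial>lborel))"
proof (rule integral_dominated_convergence[where w = "\<lambda>u. norm (f u)"])
  show "AE u in lborel. (\<lambda>k. indicator {- real k..real k} u *\<^sub>R f u) \<longlonglongrightarrow> f u"
  proof (rule AE_I2)
    fix u :: real
    obtain k0 where k0: "\<bar>u\<bar> \<le> real k0" using real_arch_simple by blast
    have "eventually (\<lambda>k. indicator {- real k..real k} u *\<^sub>R f u = f u) sequentially"
      using eventually_ge_at_top[of k0]
    proof eventually_elim
      case (elim k)
      then have "real k0 \<le> real k" by simp
      with k0 have "u \<in> {- real k..real k}" by auto
      then show ?case by simp
    qed
    then show "(\<lambda>k. indicator {- real k..real k} u *\<^sub>R f u) \<longlonglongrightarrow> f u"
      by (rule tendsto_eventually)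
  qed
qed (use assms in \<open>auto simp: indicator_def intro: borel_measurable_integrable\<close>)

lemma contour_integral_horizontal:
  fixes f :: "complex \<Rightarrow> complex"
  assumes f: "continuous_on UNIV f" and "0 < R"
  shows "contour_integral (linepath (Complex (- R) \<theta>) (Complex R \<theta>)) f
     = (\<integral>u. indicator {- R..R} u *\<^sub>R f (Complex u \<theta>) \<partial>lborel)"
proof -
  have "contour_integral (linepath (Complex (- R) \<theta>) (Complex R \<theta>)) f
     = contour_integral (linepath (of_real (- R)) (of_real R)) (\<lambda>z. f (z + Complex 0 \<theta>))"
  proof -
    have "linepath (Complex (- R) \<theta>) (Complex R \<theta>) t
        = linepath (of_real (- R)) (of_real R) t + Complex 0 \<theta>" for t
      by (simp add: linepath_def complex_eq_iff algebra_simps)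
    moreover have "Complex R \<theta> - Complex (- R) \<theta> = of_real R - of_real (- R)"
      by (simp add: complex_eq_iff)
    ultimately show ?thesis
      by (simp only: contour_integral_integral vector_derivative_linepath_at)
  qed
  also have "\<dots> = integral {- R..R} (\<lambda>u. f (complex_of_real u + Complex 0 \<theta>))"
    using \<open>0 < R\<close> by (subst contour_integral_linepath_Reals_eq) auto
  also have "\<dots> = integral {- R..R} (\<lambda>u. f (Complex u \<theta>))"
    by (intro integral_cong arg_cong[where f = f]) (simp add: complex_eq_iff)
  also have "\<dots> = (\<integral>u. indicator {- R..R} u *\<^sub>R f (Complex u \<theta>) \<partial>lborel)"
  proof -
    have "continuous_on {- R..R} (\<lambda>u. f (Complex u \<theta>))"
      by (intro continuous_on_compose2[OF f] continuous_intros) auto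
    then have "set_integrable lborel {- R..R} (\<lambda>u. f (Complex u \<theta>))"
      unfolding set_integrable_def by (intro borel_integrable_compact) auto
    from set_borel_integral_eq_integral(2)[OF this] show ?thesis
      by (simp add: set_lebesgue_integral_def)
  qed
  finally show ?thesis .
qed

text \<open>Cauchy's theorem on the rectangle with corners \<open>\<plusminus>k\<close> and \<open>\<plusminus>k + \<i> * \<theta>\<close>: the two vertical sides
contribute at most \<open>\<theta> * B (\<plusminus>k)\<close>, which vanishes as \<open>k\<close> grows.\<close>

lemma integral_shift_contour:
  fixes f :: "complex \<Rightarrow> complex" and B :: "real \<Rightarrow> real"
  assumes holo: "f holomorphic_on UNIV" and "0 \<le> \<theta>"
    and int0: "integrable lborel (\<lambda>u. f (of_real u))"
    and int1: "integrable lborel (\<lambda>u. f (Complex u \<theta>))"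
    and bound: "\<And>u \<tau>. 0 \<le> \<tau> \<Longrightarrow> \<tau> \<le> \<theta> \<Longrightarrow> cmod (f (Complex u \<tau>)) \<le> B u"
    and lim: "(B \<longlongrightarrow> 0) at_top" "(B \<longlongrightarrow> 0) at_bot"
  shows "(\<integral>u. f (of_real u) \<partial>lborel) = (\<integral>u. f (Complex u \<theta>) \<partial>lborel)"
proof -
  have cont: "continuous_on UNIV f" using holo by (rule holomorphic_on_imp_continuous_on)
  have ci: "f contour_integrable_on linepath a b" for a b
    by (intro contour_integrable_continuous_linepath continuous_on_subset[OF cont]) auto
  have of_real_eq: "complex_of_real u = Complex u 0" for u by (simp add: complex_eq_iff)
  define H where "H \<tau> k = (\<integral>u. indicator {- real k..real k} u *\<^sub>R f (Complex u \<tau>) \<partial>lborel)" for \<tau> k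
  have diff: "cmod (H 0 k - H \<theta> k) \<le> \<theta> * (B (real k) + B (- real k))" if k: "0 < k" for k
  proof -
    let ?a = "Complex (- real k) 0" and ?b = "Complex (real k) 0"
    let ?c = "Complex (real k) \<theta>" and ?d = "Complex (- real k) \<theta>"
    let ?I = "\<lambda>a b. contour_integral (linepath a b) f"
    let ?g = "linepath ?a ?b +++ linepath ?b ?c +++ linepath ?c ?d +++ linepath ?d ?a"
    have "(f has_contour_integral 0) ?g"
      by (rule Cauchy_theorem_convex_simple[OF holo]) auto
    moreover have "(f has_contour_integral (?I ?a ?b + (?I ?b ?c + (?I ?c ?d + ?I ?d ?a)))) ?g"
      by (intro has_contour_integral_join has_contour_integral_integral ci valid_path_join) auto
    ultimately have "?I ?a ?b + (?I ?b ?c + (?I ?c ?d + ?I ?d ?a)) = 0"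
      using has_contour_integral_unique by blast
    moreover have "?I ?c ?d = - ?I ?d ?c"
      using contour_integral_reverse_linepath[of ?c ?d f] continuous_on_subset[OF cont] by simp
    moreover have "?I ?a ?b = H 0 k" "?I ?d ?c = H \<theta> k"
      using k by (simp_all add: H_def contour_integral_horizontal[OF cont])
    ultimately have eq: "H 0 k - H \<theta> k = - (?I ?b ?c + ?I ?d ?a)"
      by (simp add: algebra_simps eq_neg_iff_add_eq_0)
    have vert: "cmod (?I (Complex r \<tau>1) (Complex r \<tau>2)) \<le> B r * \<bar>\<tau>2 - \<tau>1\<bar>"
      if \<tau>: "{\<tau>1, \<tau>2} = {0, \<theta>}" for r \<tau>1 \<tau>2
    proof -
      have "cmod (?I (Complex r \<tau>1) (Complex r \<tau>2)) \<le> B r * cmod (Complex r \<tau>2 - Complex r \<tau>1)"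
      proof (rule contour_integral_bound_linepath[OF ci])
        show "0 \<le> B r" using bound[of 0 r] \<open>0 \<le> \<theta>\<close> order_trans[OF norm_ge_zero] by blast
        fix z assume "z \<in> closed_segment (Complex r \<tau>1) (Complex r \<tau>2)"
        then obtain w where w: "0 \<le> w" "w \<le> 1"
          "z = (1 - w) *\<^sub>R Complex r \<tau>1 + w *\<^sub>R Complex r \<tau>2"
          unfolding closed_segment_def by blast
        have "z = Complex r ((1 - w) * \<tau>1 + w * \<tau>2)"
          unfolding w by (simp add: complex_eq_iff algebra_simps)
        moreover have "\<tau>1 \<in> {0..\<theta>}" "\<tau>2 \<in> {0..\<theta>}" using \<tau> \<open>0 \<le> \<theta>\<close>
          by (auto simp: doubleton_eq_iff)
        then have "(1 - w) *\<^sub>R \<tau>1 + w *\<^sub>R \<tau>2 \<in> {0..\<theta>}"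
          using w by (intro convexD) auto
        ultimately show "cmod (f z) \<le> B r" using bound by auto
      qed
      also have "Complex r \<tau>2 - Complex r \<tau>1 = \<i> * of_real (\<tau>2 - \<tau>1)"
        by (simp add: complex_eq_iff)
      finally show ?thesis by (simp add: norm_mult del: of_real_diff)
    qed
    have "cmod (H 0 k - H \<theta> k) \<le> cmod (?I ?b ?c) + cmod (?I ?d ?a)"
      unfolding eq norm_minus_cancel by (rule norm_triangle_ineq)
    also have "\<dots> \<le> B (real k) * \<theta> + B (- real k) * \<theta>"
      using vert[of 0 \<theta> "real k"] vert[of \<theta> 0 "- real k"] \<open>0 \<le> \<theta>\<close> by (intro add_mono) auto
    finally show ?thesis by (simp add: algebra_simps)
  qed
  have "(\<lambda>k. \<theta> * (B (real k) + B (- real k))) \<longlonglongrightarrow> \<theta> * (0 + 0)"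
    by (intro tendsto_intros filterlim_compose[OF lim(1)] filterlim_compose[OF lim(2)]
          filterlim_real_sequentially filterlim_compose[OF filterlim_uminus_at_bot_at_top])
  then have B0: "(\<lambda>k. \<theta> * (B (real k) + B (- real k))) \<longlonglongrightarrow> 0" by simp
  have "eventually (\<lambda>k. cmod (H 0 k - H \<theta> k) \<le> \<theta> * (B (real k) + B (- real k))) sequentially"
    using eventually_gt_at_top[of "0::nat"] by eventually_elim (rule diff)
  from this B0 have "(\<lambda>k. H 0 k - H \<theta> k) \<longlonglongrightarrow> 0"
    by (rule Lim_null_comparison)
  moreover have "H 0 \<longlonglongrightarrow> (\<integral>u. f (Complex u 0) \<partial>lborel)"
    unfolding H_def using int0 unfolding of_real_eq by (rule integral_lborel_interval_tendsto)
  moreover have "H \<theta> \<longlonglongrightarrow> (\<integral>u. f (Complex u \<theta>) \<partial>lborel)"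
    unfolding H_def using int1 by (rule integral_lborel_interval_tendsto)
  ultimately have "(\<integral>u. f (Complex u 0) \<partial>lborel) - (\<integral>u. f (Complex u \<theta>) \<partial>lborel) = 0"
    using tendsto_diff LIMSEQ_unique by blast
  then show ?thesis unfolding of_real_eq by simp
qed

section \<open>Brownian motion at an independent random time\<close>

text \<open>The density of \<open>W\<^sub>T\<close> when \<open>T = exp U\<close> and \<open>U\<close> has density \<open>b\<close>. The integral is linear in \<open>b\<close>,
  and \<open>b\<close> is also allowed to take negative values, so that it applies to perturbations.\<close>

definition exp_mixture :: "(real \<Rightarrow> real) \<Rightarrow> real \<Rightarrow> real" where
  "exp_mixture b y = (\<integral>u. b u * normal_density 0 (exp (u / 2)) y \<partial>lborel)"

context standard_brownian_motion
begin

text \<open>Without joint measurability the image measure in the definition of \<^const>\<open>stopped_law\<close> would carry no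
information. Paths are continuous, so \<open>W t\<close> is the limit of \<open>W\<close> at the grid points
\<open>\<lfloor>(k + 1) * t\<rfloor> / (k + 1)\<close>, which involve only countably many times.\<close>

lemma measurable_path_pair:
  "(\<lambda>(\<omega>, t). W t \<omega>) \<in> borel_measurable (M \<Otimes>\<^sub>M restrict_space borel {0..})"
proof (rule borel_measurable_LIMSEQ_real)
  let ?N = "M \<Otimes>\<^sub>M restrict_space borel {0::real..}"
  define d :: "nat \<Rightarrow> real \<Rightarrow> real" where "d k t = real (nat \<lfloor>real (Suc k) * t\<rfloor>) / real (Suc k)" for k t
  fix z assume "z \<in> space ?N"
  then obtain \<omega> t where z: "z = (\<omega>, t)" "\<omega> \<in> space M" "0 \<le> t"
    by (auto simp: space_pair_measure space_restrict_space)
  have "(\<lambda>k. d k t) \<longlonglongrightarrow> t"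
  proof (rule tendsto_sandwich[where f = "\<lambda>k. t - 1 / real (Suc k)" and h = "\<lambda>k. t"])
    have *: "d k t = of_int \<lfloor>real (Suc k) * t\<rfloor> / real (Suc k)" for k
      using z(3) by (simp add: d_def)
    have "t - 1 / real (Suc k) \<le> d k t" for k
    proof -
      have "real (Suc k) * t - 1 \<le> of_int \<lfloor>real (Suc k) * t\<rfloor>" by linarith
      then have "(real (Suc k) * t - 1) / real (Suc k) \<le> d k t"
        unfolding * by (rule divide_right_mono) simp
      then show ?thesis by (simp add: field_simps)
    qed
    then show "\<forall>\<^sub>F k in sequentially. t - 1 / real (Suc k) \<le> d k t" by simp
    have "d k t \<le> t" for k
    proof -
      have "of_int \<lfloor>real (Suc k) * t\<rfloor> \<le> real (Suc k) * t" by (rule of_int_floor_le)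
      then show ?thesis unfolding * by (simp add: field_simps del: of_nat_Suc)
    qed
    then show "\<forall>\<^sub>F k in sequentially. d k t \<le> t" by simp
    have "(\<lambda>k. t - 1 / real (Suc k)) \<longlonglongrightarrow> t - 0"
      by (intro tendsto_diff tendsto_const) (use LIMSEQ_inverse_real_of_nat in \<open>simp add: inverse_eq_divide\<close>)
    then show "(\<lambda>k. t - 1 / real (Suc k)) \<longlonglongrightarrow> t" by simp
  qed simp
  moreover have "continuous (at t within {0..}) (\<lambda>t. W t \<omega>)"
    using continuous_paths[OF z(2)] z(3) by (simp add: continuous_on_eq_continuous_within)
  moreover have "d k t \<in> {0..}" for k by (simp add: d_def)
  ultimately have "(\<lambda>k. W (d k t) \<omega>) \<longlonglongrightarrow> W t \<omega>"
    by (auto simp: continuous_within_sequentially o_def)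
  then show "(\<lambda>k. (\<lambda>(\<omega>, t). W (d k t) \<omega>) z) \<longlonglongrightarrow> (\<lambda>(\<omega>, t). W t \<omega>) z"
    by (simp add: z)
next
  fix k
  let ?N = "M \<Otimes>\<^sub>M restrict_space borel {0::real..}"
  have "(\<lambda>z. W (real (nat \<lfloor>real (Suc k) * snd z\<rfloor>) / real (Suc k)) (fst z)) \<in> borel_measurable ?N"
  proof (rule measurable_compose_countable[where f = "\<lambda>i z. W (real i / real (Suc k)) (fst z)"])
    show "(\<lambda>z. W (real i / real (Suc k)) (fst z)) \<in> borel_measurable ?N" for i
      by (rule measurable_compose[OF measurable_fst measurable_at]) simp
    have "snd \<in> borel_measurable ?N"
      by (rule measurable_compose[OF measurable_snd measurable_restrict_space1]) simp
    then show "(\<lambda>z. nat \<lfloor>real (Suc k) * snd z\<rfloor>) \<in> measurable ?N (count_space UNIV)"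
      by measurable
  qed
  then show "(\<lambda>(\<omega>, t). W (real (nat \<lfloor>real (Suc k) * t\<rfloor>) / real (Suc k)) \<omega>) \<in> borel_measurable ?N"
    by (simp add: case_prod_unfold)
qed

lemma distr_at:
  assumes "0 < t"
  shows "distr M borel (W t) = density lborel (\<lambda>y. ennreal (normal_density 0 (sqrt t) y))"
proof -
  have "distributed M lborel (\<lambda>\<omega>. W t \<omega> - W 0 \<omega>) (\<lambda>y. ennreal (normal_density 0 (sqrt (t - 0)) y))"
    using assms by (intro normal_increments) auto
  then have "distr M lborel (\<lambda>\<omega>. W t \<omega> - W 0 \<omega>) = density lborel (\<lambda>y. ennreal (normal_density 0 (sqrt t) y))"
    by (simp add: distributed_def)
  moreover have "distr M lborel (\<lambda>\<omega>. W t \<omega> - W 0 \<omega>) = distr M borel (W t)"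
    using start assms measurable_at[of t] measurable_at[of 0]
    by (intro distr_cong_AE) (auto elim: eventually_mono cong: measurable_cong_sets)
  ultimately show ?thesis by simp
qed

lemma stopped_law_exp_density:
  assumes cont: "continuous_on UNIV b" and nonneg: "\<And>u. 0 \<le> b u"
    and int: "integrable lborel b" "(\<integral>u. b u \<partial>lborel) = 1"
    and int_mix: "\<And>y. integrable lborel (\<lambda>u. b u * normal_density 0 (exp (u / 2)) y)"
  shows "stopped_law M W (exp_density b) = density lborel (\<lambda>y. ennreal (exp_mixture b y))"
proof (rule measure_eqI)
  show "sets (stopped_law M W (exp_density b)) = sets (density lborel (\<lambda>y. ennreal (exp_mixture b y)))"
    by (simp add: stopped_law_def)
  have b[measurable]: "b \<in> borel_measurable borel"
    using cont by (rule borel_measurable_continuous_onI)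
  let ?T = "time_law (exp_density b)"
  have "exp_density b \<in> time_densities"
    using cont nonneg int by (rule exp_density_in_time_densities)
  then interpret T: prob_space ?T by (simp add: time_densities_def)
  interpret P: pair_sigma_finite M ?T ..
  have sets_pair: "sets (M \<Otimes>\<^sub>M ?T) = sets (M \<Otimes>\<^sub>M restrict_space borel {0..})"
    by (intro sets_pair_measure_cong sets_time_law refl)
  have W[measurable]: "(\<lambda>(\<omega>, t). W t \<omega>) \<in> borel_measurable (M \<Otimes>\<^sub>M ?T)"
    using measurable_path_pair measurable_cong_sets[OF sets_pair refl] by blast
  have [measurable]: "(\<lambda>(u, y). normal_density 0 (exp (u / 2)) y) \<in> borel_measurable (borel \<Otimes>\<^sub>M borel)"
    unfolding normal_density_def by measurable
  fix A assume "A \<in> sets (stopped_law M W (exp_density b))"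
  then have A[measurable]: "A \<in> sets borel" by (simp add: stopped_law_def)
  have mix: "ennreal (exp_mixture b y) = (\<integral>\<^sup>+u. ennreal (b u) * ennreal (normal_density 0 (exp (u / 2)) y) \<partial>lborel)" for y
    unfolding exp_mixture_def
    by (subst nn_integral_eq_integral[symmetric, OF int_mix]) (auto simp: nonneg ennreal_mult)
  have at: "(\<integral>\<^sup>+\<omega>. indicator A (W t \<omega>) \<partial>M) = (\<integral>\<^sup>+y. ennreal (normal_density 0 (sqrt t) y) * indicator A y \<partial>lborel)"
    if "0 < t" for t
  proof -
    have "(\<integral>\<^sup>+\<omega>. indicator A (W t \<omega>) \<partial>M) = (\<integral>\<^sup>+y. indicator A y \<partial>distr M borel (W t))"
      using that measurable_at[of t] by (subst nn_integral_distr) auto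
    also have "\<dots> = (\<integral>\<^sup>+y. ennreal (normal_density 0 (sqrt t) y) * indicator A y \<partial>lborel)"
      unfolding distr_at[OF that] by (subst nn_integral_density) auto
    finally show ?thesis .
  qed
  have "emeasure (stopped_law M W (exp_density b)) A
      = (\<integral>\<^sup>+z. indicator A (case z of (\<omega>, t) \<Rightarrow> W t \<omega>) \<partial>(M \<Otimes>\<^sub>M ?T))"
    unfolding stopped_law_def
    by (subst nn_integral_indicator[symmetric], simp, subst nn_integral_distr) auto
  also have "\<dots> = (\<integral>\<^sup>+t. (\<integral>\<^sup>+\<omega>. indicator A (W t \<omega>) \<partial>M) \<partial>?T)"
    by (subst P.nn_integral_snd[symmetric]) (auto simp: case_prod_unfold)
  also have "\<dots> = (\<integral>\<^sup>+u. ennreal (b u) * (\<integral>\<^sup>+\<omega>. indicator A (W (exp u) \<omega>) \<partial>M) \<partial>lborel)"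
  proof (rule nn_integral_time_law_exp_density[OF b nonneg])
    have "(\<lambda>t. \<integral>\<^sup>+\<omega>. indicator A (W t \<omega>) \<partial>M) \<in> borel_measurable ?T"
    proof (rule borel_measurable_nn_integral)
      have "(\<lambda>z. indicator A (case z of (t, \<omega>) \<Rightarrow> W t \<omega>) :: ennreal) \<in> borel_measurable (?T \<Otimes>\<^sub>M M)"
        using measurable_compose[OF measurable_pair_swap' W] by (simp add: case_prod_unfold)
      then show "(\<lambda>(t, \<omega>). indicator A (W t \<omega>) :: ennreal) \<in> borel_measurable (?T \<Otimes>\<^sub>M M)"
        by (simp add: case_prod_unfold)
    qed
    then show "(\<lambda>t. \<integral>\<^sup>+\<omega>. indicator A (W t \<omega>) \<partial>M) \<in> borel_measurable (restrict_space borel {0..})"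
      by (simp add: sets_time_law cong: measurable_cong_sets)
  qed
  also have "\<dots> = (\<integral>\<^sup>+u. (\<integral>\<^sup>+y. ennreal (b u) * ennreal (normal_density 0 (exp (u / 2)) y) * indicator A y \<partial>lborel) \<partial>lborel)"
  proof (rule nn_integral_cong)
    fix u :: real
    have s: "sqrt (exp u) = exp (u / 2)"
      by (rule real_sqrt_unique) (auto simp flip: exp_double)
    show "ennreal (b u) * (\<integral>\<^sup>+\<omega>. indicator A (W (exp u) \<omega>) \<partial>M)
      = (\<integral>\<^sup>+y. ennreal (b u) * ennreal (normal_density 0 (exp (u / 2)) y) * indicator A y \<partial>lborel)"
      unfolding at[OF exp_gt_zero] s
      by (subst nn_integral_cmult[symmetric]) (auto simp: mult.assoc)
  qed
  also have "\<dots> = (\<integral>\<^sup>+y. (\<integral>\<^sup>+u. ennreal (b u) * ennreal (normal_density 0 (exp (u / 2)) y) * indicator A y \<partial>lborel) \<partial>lborel)"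
    by (rule lborel_pair.Fubini'[symmetric]) measurable
  also have "\<dots> = (\<integral>\<^sup>+y. ennreal (exp_mixture b y) * indicator A y \<partial>lborel)"
    unfolding mix by (intro nn_integral_cong nn_integral_multc) measurable
  also have "\<dots> = emeasure (density lborel (\<lambda>y. ennreal (exp_mixture b y))) A"
    by (subst emeasure_density) (auto simp: mix)
  finally show "emeasure (stopped_law M W (exp_density b)) A
      = emeasure (density lborel (\<lambda>y. ennreal (exp_mixture b y))) A" .
qed

end

section \<open>Testing two product measures\<close>

text \<open>The two densities in the final comparison give product measures whose likelihood ratio is the product
of the individual likelihood ratios.\<close>

lemma PiM_density:
  fixes P :: "'b measure" and r :: "'b \<Rightarrow> ennreal"
  assumes "prob_space P" "prob_space (density P r)" "finite I" and r[measurable]: "r \<in> borel_measurable P"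
  shows "(\<Pi>\<^sub>M i\<in>I. density P r) = density (\<Pi>\<^sub>M i\<in>I. P) (\<lambda>X. \<Prod>i\<in>I. r (X i))"
proof -
  interpret P: prob_space P by fact
  interpret Q: prob_space "density P r" by fact
  interpret PP: product_sigma_finite "\<lambda>_. P" by standard
  interpret QQ: product_sigma_finite "\<lambda>_. density P r" by standard
  have prod[measurable]: "(\<lambda>X. \<Prod>i\<in>I. r (X i)) \<in> borel_measurable (\<Pi>\<^sub>M i\<in>I. P)"
    by (intro borel_measurable_prod_ennreal, rule measurable_compose[OF _ r]) simp
  show ?thesis
  proof (rule QQ.PiM_eqI[symmetric, OF \<open>finite I\<close>])
    show "sets (density (\<Pi>\<^sub>M i\<in>I. P) (\<lambda>X. \<Prod>i\<in>I. r (X i))) = sets (\<Pi>\<^sub>M i\<in>I. density P r)"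
      by (simp cong: sets_PiM_cong)
  next
    fix A assume "\<And>i. i \<in> I \<Longrightarrow> A i \<in> sets (density P r)"
    then have A: "\<And>i. i \<in> I \<Longrightarrow> A i \<in> sets P" by simp
    have "emeasure (density (\<Pi>\<^sub>M i\<in>I. P) (\<lambda>X. \<Prod>i\<in>I. r (X i))) (Pi\<^sub>E I A)
        = (\<integral>\<^sup>+X. (\<Prod>i\<in>I. r (X i)) * indicator (Pi\<^sub>E I A) X \<partial>(\<Pi>\<^sub>M i\<in>I. P))"
      using A \<open>finite I\<close> by (subst emeasure_density) (auto intro: sets_PiM_I_finite)
    also have "\<dots> = (\<integral>\<^sup>+X. (\<Prod>i\<in>I. r (X i) * indicator (A i) (X i)) \<partial>(\<Pi>\<^sub>M i\<in>I. P))"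
    proof (rule nn_integral_cong)
      fix X assume "X \<in> space (\<Pi>\<^sub>M i\<in>I. P)"
      then have "indicator (Pi\<^sub>E I A) X = (\<Prod>i\<in>I. indicator (A i) (X i) :: ennreal)"
        using \<open>finite I\<close> by (auto simp: indicator_def PiE_def Pi_def space_PiM prod_zero_iff)
      then show "(\<Prod>i\<in>I. r (X i)) * indicator (Pi\<^sub>E I A) X = (\<Prod>i\<in>I. r (X i) * indicator (A i) (X i))"
        by (simp add: prod.distrib)
    qed
    also have "\<dots> = (\<Prod>i\<in>I. \<integral>\<^sup>+x. r x * indicator (A i) x \<partial>P)"
      using A by (intro PP.product_nn_integral_prod \<open>finite I\<close>) auto
    also have "\<dots> = (\<Prod>i\<in>I. emeasure (density P r) (A i))"
      using A by (intro prod.cong refl) (simp add: emeasure_density)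
    finally show "emeasure (density (\<Pi>\<^sub>M i\<in>I. P) (\<lambda>X. \<Prod>i\<in>I. r (X i))) (Pi\<^sub>E I A)
        = (\<Prod>i\<in>I. emeasure (density P r) (A i))" .
  qed
qed

text \<open>Second moments of likelihood ratios multiply, and \<open>(1 + 1/n) ^ n \<le> exp 1 \<le> 3\<close>. A deviation of order
\<open>1 / sqrt n\<close> of the one-sample likelihood ratio from \<open>1\<close> is thus invisible in \<open>n\<close> observations.\<close>

lemma product_likelihood_second_moment:
  fixes P :: "'b measure" and r :: "'b \<Rightarrow> real"
  assumes "prob_space P" and [measurable]: "r \<in> borel_measurable P"
    and chi: "(\<integral>\<^sup>+x. (ennreal (r x))\<^sup>2 \<partial>P) \<le> ennreal (1 + 1 / real n)" and "0 < n"
  shows "(\<integral>\<^sup>+X. (\<Prod>i\<in>{1..n}. ennreal (r (X i)))\<^sup>2 \<partial>(\<Pi>\<^sub>M i\<in>{1..n}. P)) \<le> 3"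
proof -
  interpret P: prob_space P by fact
  interpret PP: product_sigma_finite "\<lambda>_. P" by standard
  have "(\<integral>\<^sup>+X. (\<Prod>i\<in>{1..n}. ennreal (r (X i)))\<^sup>2 \<partial>(\<Pi>\<^sub>M i\<in>{1..n}. P))
      = (\<integral>\<^sup>+X. (\<Prod>i\<in>{1..n}. (ennreal (r (X i)))\<^sup>2) \<partial>(\<Pi>\<^sub>M i\<in>{1..n}. P))"
    by (simp add: prod_power_distrib)
  also have "\<dots> = (\<Prod>i\<in>{1..n}. \<integral>\<^sup>+x. (ennreal (r x))\<^sup>2 \<partial>P)"
    by (rule PP.product_nn_integral_prod) auto
  also have "\<dots> \<le> (\<Prod>i\<in>{1..n}. ennreal (1 + 1 / real n))"
    using chi by (intro prod_mono_ennreal)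
  also have "\<dots> = ennreal ((1 + 1 / real n) ^ n)"
    by (simp add: ennreal_power del: ennreal_plus)
  also have "\<dots> \<le> ennreal 3"
  proof (rule ennreal_leI)
    have "(1 + 1 / real n) ^ n \<le> exp (1 / real n) ^ n"
      by (intro power_mono) (auto simp: exp_ge_add_one_self)
    also have "exp (1 / real n) ^ n = exp 1"
      using \<open>0 < n\<close> by (simp flip: exp_of_nat_mult)
    also have "exp 1 \<le> (3::real)" by (rule exp_le)
    finally show "(1 + 1 / real n) ^ n \<le> 3" .
  qed
  finally show ?thesis by simp
qed

text \<open>Le Cam's two-point inequality. The bounded second moment of \<open>\<Lambda>\<close> prevents \<open>A\<close> from being rare under
\<open>P\<close> and almost certain under \<open>density P \<Lambda>\<close>. Hence if \<open>A\<close> is rare under \<open>P\<close>, then \<open>B\<close>, which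
contains the complement of \<open>A\<close>, is likely under \<open>density P \<Lambda>\<close>.\<close>

lemma two_point_testing:
  fixes P :: "'b measure" and \<Lambda> :: "'b \<Rightarrow> ennreal"
  assumes "prob_space P" "prob_space (density P \<Lambda>)"
    and [measurable]: "\<Lambda> \<in> borel_measurable P" "A \<in> sets P" "B \<in> sets P"
    and second: "(\<integral>\<^sup>+X. (\<Lambda> X)\<^sup>2 \<partial>P) \<le> 3"
    and cover: "space P \<subseteq> A \<union> B"
  shows "1 / 8 \<le> emeasure P A \<or> 1 / 8 \<le> emeasure (density P \<Lambda>) B"
proof (rule disjCI)
  assume "\<not> 1 / 8 \<le> emeasure (density P \<Lambda>) B"
  interpret P: prob_space P by fact
  interpret Q: prob_space "density P \<Lambda>" by fact
  have "emeasure (density P \<Lambda>) A \<le> 3 / 8 + 2 * emeasure P A"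
  proof -
    \<comment> \<open>The arithmetic-geometric mean inequality replaces Cauchy-Schwarz here; the constants make
      \<open>3/8 + 2/8 + 1/8 < 1\<close>.\<close>
    have amgm: "\<Lambda> X * indicator A X \<le> (\<Lambda> X)\<^sup>2 / 8 + 2 * indicator A X" for X
    proof (cases "\<Lambda> X")
      case (real l)
      have "0 \<le> (l - 4)\<^sup>2" by simp
      then have "l \<le> l\<^sup>2 / 8 + 2" by (simp add: power2_eq_square algebra_simps)
      then have "ennreal l \<le> ennreal (l\<^sup>2 / 8 + 2)" by (rule ennreal_leI)
      also have "\<dots> = (ennreal l)\<^sup>2 / 8 + 2"
        using real by (simp add: ennreal_power divide_ennreal flip: ennreal_numeral ennreal_plus)
      finally show ?thesis using real by (simp add: indicator_def)
    next
      case top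
      then show ?thesis by (simp add: power2_eq_square ennreal_top_mult ennreal_top_divide)
    qed
    have "emeasure (density P \<Lambda>) A = (\<integral>\<^sup>+X. \<Lambda> X * indicator A X \<partial>P)"
      by (simp add: emeasure_density)
    also have "\<dots> \<le> (\<integral>\<^sup>+X. (\<Lambda> X)\<^sup>2 / 8 + 2 * indicator A X \<partial>P)"
      by (intro nn_integral_mono amgm)
    also have "\<dots> = (\<integral>\<^sup>+X. (\<Lambda> X)\<^sup>2 \<partial>P) / 8 + 2 * emeasure P A"
      by (simp add: nn_integral_add nn_integral_divide nn_integral_cmult)
    also have "\<dots> \<le> 3 / 8 + 2 * emeasure P A"
      using second by (intro add_mono divide_right_mono_ennreal) auto
    finally show ?thesis .
  qed
  moreover have "1 \<le> emeasure (density P \<Lambda>) A + emeasure (density P \<Lambda>) B"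
  proof -
    have "1 = emeasure (density P \<Lambda>) (space (density P \<Lambda>))" by (simp only: Q.emeasure_space_1)
    also have "\<dots> \<le> emeasure (density P \<Lambda>) (A \<union> B)"
      using cover by (intro emeasure_mono) auto
    also have "\<dots> \<le> emeasure (density P \<Lambda>) A + emeasure (density P \<Lambda>) B"
      by (intro emeasure_subadditive) auto
    finally show ?thesis .
  qed
  ultimately have "1 \<le> 3 / 8 + 2 * emeasure P A + emeasure (density P \<Lambda>) B"
    by (meson add_right_mono order_trans)
  then have "ennreal 1 \<le> ennreal (3 / 8 + 2 * P.prob A + Q.prob B)"
    using divide_ennreal[of 3 8]
    by (simp add: P.emeasure_eq_measure Q.emeasure_eq_measure ennreal_mult)
  then have "1 \<le> 3 / 8 + 2 * P.prob A + Q.prob B"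
    by (subst (asm) ennreal_le_iff) auto
  moreover have "Q.prob B < 1 / 8"
  proof -
    have "\<not> ennreal (1 / 8) \<le> ennreal (Q.prob B)"
      using \<open>\<not> 1 / 8 \<le> _\<close> by (simp add: Q.emeasure_eq_measure divide_ennreal flip: ennreal_numeral ennreal_1)
    then show ?thesis by (meson ennreal_leI linorder_not_less)
  qed
  ultimately have "1 / 8 \<le> P.prob A" by simp
  then have "ennreal (1 / 8) \<le> ennreal (P.prob A)" by (rule ennreal_leI)
  then show "1 / 8 \<le> emeasure P A"
    by (simp add: P.emeasure_eq_measure divide_ennreal flip: ennreal_numeral ennreal_1)
qed

section \<open>Reduction to two hypotheses\<close>

text \<open>The densities \<open>b\<close> of \<open>U\<close> for which \<open>exp U\<close> is an admissible time: continuity transfers to the density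
of \<open>exp U\<close>, and integrability against the normal kernel makes \<^const>\<open>exp_mixture\<close> a genuine density.\<close>

locale log_time_density =
  fixes b :: "real \<Rightarrow> real"
  assumes continuous: "continuous_on UNIV b"
    and nonneg: "0 \<le> b u"
    and integrable: "integrable lborel b"
    and integral_eq_1: "(\<integral>u. b u \<partial>lborel) = 1"
    and integrable_mixture: "integrable lborel (\<lambda>u. b u * normal_density 0 (exp (u / 2)) y)"

lemma measurable_exp_mixture [measurable]:
  assumes [measurable]: "b \<in> borel_measurable borel"
  shows "exp_mixture b \<in> borel_measurable borel"
  unfolding exp_mixture_def[abs_def] normal_density_def by measurable

context standard_brownian_motion
begin

lemma prob_space_stopped_law:
  assumes "p \<in> time_densities"
  shows "prob_space (stopped_law M W p)"
proof -
  interpret T: prob_space "time_law p" using assms by (simp add: time_densities_def)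
  interpret P: pair_prob_space M "time_law p" ..
  have "sets (M \<Otimes>\<^sub>M time_law p) = sets (M \<Otimes>\<^sub>M restrict_space borel {0..})"
    by (intro sets_pair_measure_cong sets_time_law refl)
  then have "(\<lambda>(\<omega>, t). W t \<omega>) \<in> borel_measurable (M \<Otimes>\<^sub>M time_law p)"
    using measurable_path_pair measurable_cong_sets[OF _ refl] by blast
  then show ?thesis unfolding stopped_law_def by (rule P.prob_space_distr)
qed

text \<open>A pointwise relative bound \<open>\<alpha> \<le> 1 / sqrt n\<close> on the difference of the two densities of \<open>W\<^sub>T\<close> bounds the
second moment of the likelihood ratio \<open>\<rho>\<close> by \<open>1 + \<alpha>\<^sup>2\<close>, because \<open>\<rho>\<close> has mean \<open>1\<close>. Since the two
values at \<open>x\<close> are \<open>2 * r\<close> apart, every sample makes the estimator err by \<open>r\<close> for one of them.\<close>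

lemma two_point_minimax:
  assumes "log_time_density b0" "log_time_density b1"
    and mem: "exp_density b0 \<in> \<P>" "exp_density b1 \<in> \<P>"
    and pos: "\<And>y. 0 < exp_mixture b0 y"
    and close: "\<And>y. \<bar>exp_mixture b1 y - exp_mixture b0 y\<bar> \<le> \<alpha> * exp_mixture b0 y"
    and "0 < n" and \<alpha>: "real n * \<alpha>\<^sup>2 \<le> 1"
    and separated: "2 * r \<le> \<bar>exp_density b1 x - exp_density b0 x\<bar>"
    and q: "q \<in> estimators n"
  shows "1 / 8 \<le> (SUP p\<in>\<P>. emeasure (sample_law M W n p)
           {X \<in> space (sample_law M W n p). \<bar>p x - q X x\<bar> \<ge> r})"
proof -
  interpret b0: log_time_density b0 by fact
  interpret b1: log_time_density b1 by fact
  have [measurable]: "b0 \<in> borel_measurable borel" "b1 \<in> borel_measurable borel"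
    by (rule borel_measurable_continuous_onI b0.continuous b1.continuous)+
  let ?q0 = "exp_mixture b0" and ?q1 = "exp_mixture b1"
  define \<rho> where "\<rho> y = ?q1 y / ?q0 y" for y
  have [measurable]: "\<rho> \<in> borel_measurable borel" unfolding \<rho>_def[abs_def] by measurable
  have q1_nonneg: "0 \<le> ?q1 y" for y
    unfolding exp_mixture_def by (intro Bochner_Integration.integral_nonneg) (simp add: b1.nonneg)
  then have \<rho>_nonneg: "0 \<le> \<rho> y" for y using pos[of y] by (simp add: \<rho>_def)
  let ?P = "stopped_law M W (exp_density b0)" and ?Q = "stopped_law M W (exp_density b1)"
  have P: "?P = density lborel (\<lambda>y. ennreal (?q0 y))"
    using b0.continuous b0.nonneg b0.integrable b0.integral_eq_1 b0.integrable_mixture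
    by (rule stopped_law_exp_density)
  have "?Q = density lborel (\<lambda>y. ennreal (?q1 y))"
    using b1.continuous b1.nonneg b1.integrable b1.integral_eq_1 b1.integrable_mixture
    by (rule stopped_law_exp_density)
  also have "\<dots> = density ?P (\<lambda>y. ennreal (\<rho> y))"
    unfolding P
    by (subst density_density_eq)
      (use pos in \<open>auto simp: \<rho>_def less_imp_le q1_nonneg less_imp_neq[symmetric] intro!: density_cong simp flip: ennreal_mult\<close>)
  finally have Q: "?Q = density ?P (\<lambda>y. ennreal (\<rho> y))" .
  have PS: "prob_space ?P" "prob_space ?Q"
    by (intro prob_space_stopped_law exp_density_in_time_densities b0.continuous b0.nonneg
        b0.integrable b0.integral_eq_1 b1.continuous b1.nonneg b1.integrable b1.integral_eq_1)+
  then interpret P: prob_space ?P + Q: prob_space ?Q .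
  have sets_P: "sets ?P = sets borel" by (simp add: stopped_law_def)
  have \<rho>_meas[measurable]: "\<rho> \<in> borel_measurable ?P" by (simp add: P)
  have chi: "(\<integral>\<^sup>+y. (ennreal (\<rho> y))\<^sup>2 \<partial>?P) \<le> ennreal (1 + 1 / real n)"
  proof -
    \<comment> \<open>\<open>(\<rho> - 1)\<^sup>2 \<le> \<alpha>\<^sup>2\<close>, arranged without subtraction.\<close>
    have pw: "(ennreal (\<rho> y))\<^sup>2 + 1 \<le> 2 * ennreal (\<rho> y) + ennreal (1 / real n)" for y
    proof -
      have "\<bar>\<rho> y - 1\<bar> = \<bar>?q1 y - ?q0 y\<bar> / ?q0 y"
        using pos[of y] by (simp add: \<rho>_def field_simps abs_if)
      also have "\<dots> \<le> \<alpha>" using close[of y] pos[of y] by (simp add: divide_simps)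
      finally have "(\<rho> y - 1)\<^sup>2 \<le> \<alpha>\<^sup>2" by (simp add: abs_le_square_iff[symmetric])
      also have "\<dots> \<le> 1 / real n" using \<alpha> \<open>0 < n\<close> by (simp add: field_simps)
      finally have "(\<rho> y)\<^sup>2 + 1 \<le> 2 * \<rho> y + 1 / real n"
        by (simp add: power2_eq_square algebra_simps)
      then have "ennreal ((\<rho> y)\<^sup>2 + 1) \<le> ennreal (2 * \<rho> y + 1 / real n)" by (rule ennreal_leI)
      then show ?thesis using \<rho>_nonneg[of y] by (simp add: ennreal_power ennreal_mult)
    qed
    have "(\<integral>\<^sup>+y. (ennreal (\<rho> y))\<^sup>2 \<partial>?P) + 1 = (\<integral>\<^sup>+y. (ennreal (\<rho> y))\<^sup>2 + 1 \<partial>?P)"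
      by (subst nn_integral_add) (auto simp: P.emeasure_space_1)
    also have "\<dots> \<le> (\<integral>\<^sup>+y. 2 * ennreal (\<rho> y) + ennreal (1 / real n) \<partial>?P)"
      by (intro nn_integral_mono pw)
    also have "\<dots> = 2 * (\<integral>\<^sup>+y. ennreal (\<rho> y) \<partial>?P) + ennreal (1 / real n)"
      by (simp add: nn_integral_add nn_integral_cmult P.emeasure_space_1)
    also have "(\<integral>\<^sup>+y. ennreal (\<rho> y) \<partial>?P) = emeasure ?Q (space ?P)"
      unfolding Q by (subst emeasure_density) (auto intro!: nn_integral_cong)
    also have "\<dots> = 1" using Q.emeasure_space_1 by (simp add: stopped_law_def)
    finally have "(\<integral>\<^sup>+y. (ennreal (\<rho> y))\<^sup>2 \<partial>?P) + 1 \<le> ennreal (1 + 1 / real n) + 1"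
      by (simp add: add_ac flip: one_add_one)
    then show ?thesis by (simp add: ennreal_add_left_cancel_le add.commute[of _ 1])
  qed
  let ?PP = "\<Pi>\<^sub>M i\<in>{1..n}. ?P"
  define \<Lambda> where "\<Lambda> X = (\<Prod>i\<in>{1..n}. ennreal (\<rho> (X i)))" for X :: "nat \<Rightarrow> real"
  have PPs: "prob_space ?PP" "prob_space (\<Pi>\<^sub>M i\<in>{1..n}. ?Q)"
    by (intro prob_space_PiM PS)+
  have QQ: "(\<Pi>\<^sub>M i\<in>{1..n}. ?Q) = density ?PP \<Lambda>"
    unfolding Q \<Lambda>_def[abs_def] using PS Q by (intro PiM_density) auto
  have L2: "(\<integral>\<^sup>+X. (\<Lambda> X)\<^sup>2 \<partial>?PP) \<le> 3"
    unfolding \<Lambda>_def using PS(1) \<rho>_meas chi \<open>0 < n\<close> by (rule product_likelihood_second_moment)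
  have \<Lambda>_meas[measurable]: "\<Lambda> \<in> borel_measurable ?PP"
    unfolding \<Lambda>_def[abs_def]
    by (intro borel_measurable_prod_ennreal, rule measurable_compose[OF _ measurable_compose[OF \<rho>_meas measurable_ennreal]]) simp
  have "sets ?PP = sets (\<Pi>\<^sub>M i\<in>{1..n}. borel)" by (intro sets_PiM_cong refl sets_P)
  then have "borel_measurable ?PP = (borel_measurable (\<Pi>\<^sub>M i\<in>{1..n}. borel) :: ((nat \<Rightarrow> real) \<Rightarrow> real) set)"
    by (rule measurable_cong_sets) (rule refl)
  then have q_meas[measurable]: "(\<lambda>X. q X x) \<in> borel_measurable ?PP"
    using q by (simp add: estimators_def)
  let ?A = "\<lambda>p. {X \<in> space ?PP. \<bar>p x - q X x\<bar> \<ge> r}"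
  have "1 / 8 \<le> emeasure ?PP (?A (exp_density b0)) \<or> 1 / 8 \<le> emeasure (density ?PP \<Lambda>) (?A (exp_density b1))"
  proof (rule two_point_testing)
    show "prob_space ?PP" by (rule PPs(1))
    show "prob_space (density ?PP \<Lambda>)" using PPs(2) unfolding QQ .
    show "space ?PP \<subseteq> ?A (exp_density b0) \<union> ?A (exp_density b1)"
      using separated by auto
  qed (use L2 in measurable)
  then obtain p where "p \<in> \<P>"
    "1 / 8 \<le> emeasure (sample_law M W n p) {X \<in> space (sample_law M W n p). \<bar>p x - q X x\<bar> \<ge> r}"
    using mem unfolding sample_law_def QQ[symmetric] by (auto simp: space_PiM stopped_law_def)
  then show ?thesis by (meson SUP_upper order_trans)
qed

end

section \<open>Gaussian integrals\<close>

lemma normal_density_tilt: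
  assumes "0 < s"
  shows "normal_density \<mu> s u * exp (c * u)
    = exp (c * \<mu> + c\<^sup>2 * s\<^sup>2 / 2) * normal_density (\<mu> + c * s\<^sup>2) s u"
proof -
  have "- (u - \<mu>)\<^sup>2 / (2 * s\<^sup>2) + c * u
      = (c * \<mu> + c\<^sup>2 * s\<^sup>2 / 2) + - (u - (\<mu> + c * s\<^sup>2))\<^sup>2 / (2 * s\<^sup>2)"
    using assms by (simp add: field_simps power2_eq_square)
  then show ?thesis
    by (simp add: normal_density_def exp_add[symmetric])
qed

lemma integrable_normal_density_exp:
  assumes "0 < s"
  shows "integrable lborel (\<lambda>u. normal_density \<mu> s u * exp (c * u))"
  using assms by (simp add: normal_density_tilt)

text \<open>The affine substitution \<open>u = \<mu> + s * x\<close> reduces this to the characteristic function of the standard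
normal law.\<close>

lemma char_normal_density:
  assumes "0 < s"
  shows "(\<integral>u. complex_of_real (normal_density \<mu> s u) * iexp (w * u) \<partial>lborel)
    = iexp (w * \<mu>) * of_real (exp (- (s\<^sup>2 * w\<^sup>2 / 2)))"
proof -
  have "(\<integral>u. complex_of_real (normal_density \<mu> s u) * iexp (w * u) \<partial>lborel)
      = s *\<^sub>R (\<integral>x. complex_of_real (normal_density \<mu> s (\<mu> + s * x)) * iexp (w * (\<mu> + s * x)) \<partial>lborel)"
    using assms by (subst lborel_integral_real_affine[where c = s and t = \<mu>]) auto
  also have "\<dots> = (\<integral>x. iexp (w * \<mu>) * (std_normal_density x *\<^sub>R iexp (w * s * x)) \<partial>lborel)"
    unfolding integral_scaleR_right[symmetric]
  proof (rule Bochner_Integration.integral_cong[OF refl])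
    fix x :: real
    have "s * normal_density \<mu> s (\<mu> + s * x) = std_normal_density x"
      using assms by (simp add: normal_density_def real_sqrt_mult power_mult_distrib field_simps)
    then have "complex_of_real s * complex_of_real (normal_density \<mu> s (\<mu> + s * x)) = complex_of_real (std_normal_density x)"
      by (metis of_real_mult)
    moreover have "iexp (w * (\<mu> + s * x)) = iexp (w * \<mu>) * iexp (w * s * x)"
      by (simp add: algebra_simps flip: exp_add)
    ultimately show "s *\<^sub>R (complex_of_real (normal_density \<mu> s (\<mu> + s * x)) * iexp (w * (\<mu> + s * x)))
        = iexp (w * \<mu>) * (std_normal_density x *\<^sub>R iexp (w * s * x))"
      by (simp add: scaleR_conv_of_real mult_ac)
  qed
  also have "\<dots> = iexp (w * \<mu>) * char std_normal_distribution (w * s)"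
  proof -
    have "char std_normal_distribution (w * s) = (\<integral>x. std_normal_density x *\<^sub>R iexp (w * s * x) \<partial>lborel)"
      unfolding char_def by (subst integral_density) auto
    then show ?thesis by (simp only: integral_mult_right_zero)
  qed
  also have "char std_normal_distribution (w * s) = of_real (exp (- (s\<^sup>2 * w\<^sup>2 / 2)))"
    by (simp add: char_std_normal_distribution power_mult_distrib mult.commute)
  finally show ?thesis .
qed

text \<open>In this form the normal kernel of variance \<open>exp u\<close> extends to an entire function of \<open>u\<close>.\<close>

lemma normal_density_exp_half:
  "normal_density 0 (exp (u / 2)) y
    = 1 / sqrt (2 * pi) * exp (- (u / 2) - y\<^sup>2 / 2 * exp (- u))"
proof -
  have "(exp (u / 2))\<^sup>2 = exp u" by (simp flip: exp_double)
  then have "- (y - 0)\<^sup>2 / (2 * (exp (u / 2))\<^sup>2) = - (y\<^sup>2 / 2 * exp (- u))"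
    by (simp add: exp_minus field_simps)
  moreover have "1 / sqrt (2 * pi * (exp (u / 2))\<^sup>2) = 1 / sqrt (2 * pi) * exp (- (u / 2))"
    by (simp add: real_sqrt_mult exp_minus field_simps)
  ultimately have "normal_density 0 (exp (u / 2)) y
      = 1 / sqrt (2 * pi) * (exp (- (u / 2)) * exp (- (y\<^sup>2 / 2 * exp (- u))))"
    unfolding normal_density_def by (simp only: mult.assoc)
  then show ?thesis by (simp only: exp_add[symmetric] diff_conv_add_uminus)
qed

lemma integrable_normal_mixture:
  assumes "0 < s"
  shows "integrable lborel (\<lambda>u. normal_density \<mu> s u * normal_density 0 (exp (u / 2)) y)"
proof (rule Bochner_Integration.integrable_bound[OF integrable_normal_density_exp[OF assms, of \<mu> "- 1 / 2"]])
  show "(\<lambda>u. normal_density \<mu> s u * normal_density 0 (exp (u / 2)) y) \<in> borel_measurable lborel"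
    unfolding normal_density_def by measurable
  show "AE u in lborel. norm (normal_density \<mu> s u * normal_density 0 (exp (u / 2)) y)
      \<le> norm (normal_density \<mu> s u * exp (- 1 / 2 * u))"
  proof (rule AE_I2)
    fix u :: real
    have "1 / sqrt (2 * pi) * exp (- (u / 2) - y\<^sup>2 / 2 * exp (- u)) \<le> 1 * exp (- 1 / 2 * u)"
      using pi_ge_two by (intro mult_mono) auto
    from mult_left_mono[OF this normal_density_nonneg[of \<mu> s u]]
    show "norm (normal_density \<mu> s u * normal_density 0 (exp (u / 2)) y)
      \<le> norm (normal_density \<mu> s u * exp (- 1 / 2 * u))"
      by (simp add: normal_density_exp_half abs_mult)
  qed
qed

text \<open>This is where observing \<open>W\<^sub>T\<close> instead of \<open>T\<close> loses information. Shift the line of integration to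
\<open>Im z = \<theta>\<close>. The oscillation contributes \<open>exp (- V * \<theta>)\<close>, the Gaussian grows only by
\<open>exp (\<theta>\<^sup>2 / (2 * s\<^sup>2))\<close>, and the kernel has, up to a constant factor, the modulus
\<open>exp (- (u / 2) - y\<^sup>2 / 2 * exp (- u) * cos \<theta>)\<close>. Since \<open>cos \<theta> = exp (- a)\<close>, the substitution \<open>u \<mapsto> u - a\<close>
restores the original kernel and moves the mean of the Gaussian to \<open>\<mu> + a\<close>, at the price of the
factor \<open>exp (a / 2)\<close>.\<close>

lemma oscillating_mixture_bound:
  assumes "0 < s" "0 \<le> V" "0 \<le> \<theta>" "\<theta> < pi / 2" and a: "exp (- a) = cos \<theta>"
  shows "cmod (\<integral>u. complex_of_real (normal_density \<mu> s u * normal_density 0 (exp (u / 2)) y) * iexp (V * (u - \<mu>)) \<partial>lborel)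
    \<le> exp (\<theta>\<^sup>2 / (2 * s\<^sup>2) - V * \<theta> + a / 2) * exp_mixture (normal_density (\<mu> + a) s) y"
proof -
  define K where "K = 1 / sqrt (2 * pi * s\<^sup>2) * (1 / sqrt (2 * pi))"
  define f where "f z = of_real K * exp (- (z - of_real \<mu>)\<^sup>2 / of_real (2 * s\<^sup>2) + \<i> * of_real V * (z - of_real \<mu>)
      - z / 2 - of_real (y\<^sup>2 / 2) * exp (- z))" for z :: complex
  have K: "0 < K" using \<open>0 < s\<close> by (simp add: K_def)
  have f_real: "f (of_real u) = complex_of_real (normal_density \<mu> s u * normal_density 0 (exp (u / 2)) y) * iexp (V * (u - \<mu>))" for u
  proof -
    have "f (of_real u) = of_real K * exp (of_real (- (u - \<mu>)\<^sup>2 / (2 * s\<^sup>2)) + \<i> * of_real (V * (u - \<mu>))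
        + of_real (- (u / 2) - y\<^sup>2 / 2 * exp (- u)))"
      by (simp add: f_def exp_of_real[symmetric] algebra_simps)
    also have "\<dots> = of_real (K * exp (- (u - \<mu>)\<^sup>2 / (2 * s\<^sup>2)) * exp (- (u / 2) - y\<^sup>2 / 2 * exp (- u))) * iexp (V * (u - \<mu>))"
      by (simp only: exp_add exp_of_real of_real_mult mult_ac)
    also have "K * exp (- (u - \<mu>)\<^sup>2 / (2 * s\<^sup>2)) * exp (- (u / 2) - y\<^sup>2 / 2 * exp (- u))
        = normal_density \<mu> s u * normal_density 0 (exp (u / 2)) y"
      by (simp only: normal_density_exp_half normal_density_def[of \<mu>] K_def mult_ac)
    finally show ?thesis .
  qed
  have norm_f: "cmod (f (Complex u \<tau>))
      = K * exp (- (u - \<mu>)\<^sup>2 / (2 * s\<^sup>2) + \<tau>\<^sup>2 / (2 * s\<^sup>2) - V * \<tau> - u / 2 - y\<^sup>2 / 2 * (exp (- u) * cos \<tau>))" for u \<tau>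
  proof -
    have "Re (- (Complex u \<tau> - of_real \<mu>)\<^sup>2 / of_real (2 * s\<^sup>2)) = - (u - \<mu>)\<^sup>2 / (2 * s\<^sup>2) + \<tau>\<^sup>2 / (2 * s\<^sup>2)"
      unfolding Re_divide_of_real by (simp add: power2_eq_square diff_divide_distrib)
    moreover have "Re (\<i> * of_real V * (Complex u \<tau> - of_real \<mu>)) = - V * \<tau>" by simp
    moreover have "Re (of_real (y\<^sup>2 / 2) * exp (- Complex u \<tau>)) = y\<^sup>2 / 2 * (exp (- u) * cos \<tau>)"
    proof -
      have "Re (of_real c * z) = c * Re z" for c z by simp
      then show ?thesis by (simp only: Re_exp uminus_complex.sel complex.sel cos_minus)
    qed
    ultimately have "Re (- (Complex u \<tau> - of_real \<mu>)\<^sup>2 / of_real (2 * s\<^sup>2) + \<i> * of_real V * (Complex u \<tau> - of_real \<mu>)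
      - Complex u \<tau> / 2 - of_real (y\<^sup>2 / 2) * exp (- Complex u \<tau>))
      = - (u - \<mu>)\<^sup>2 / (2 * s\<^sup>2) + \<tau>\<^sup>2 / (2 * s\<^sup>2) - V * \<tau> - u / 2 - y\<^sup>2 / 2 * (exp (- u) * cos \<tau>)"
      unfolding minus_complex.sel plus_complex.sel by simp
    then show ?thesis using K by (simp only: f_def norm_mult norm_exp_eq_Re norm_of_real abs_of_pos)
  qed
  define B where "B u = K * exp (- (u - \<mu>)\<^sup>2 / (2 * s\<^sup>2) + \<theta>\<^sup>2 / (2 * s\<^sup>2) - u / 2)" for u
  have f_le: "cmod (f (Complex u \<tau>)) \<le> B u" if "0 \<le> \<tau>" "\<tau> \<le> \<theta>" for u \<tau>
  proof -
    have "0 \<le> cos \<tau>" using that \<open>\<theta> < pi / 2\<close> by (intro cos_ge_zero) auto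
    then have "0 \<le> y\<^sup>2 / 2 * (exp (- u) * cos \<tau>)" by simp
    moreover have "0 \<le> V * \<tau>" using that \<open>0 \<le> V\<close> by simp
    moreover have "\<tau>\<^sup>2 / (2 * s\<^sup>2) \<le> \<theta>\<^sup>2 / (2 * s\<^sup>2)"
      using that \<open>0 < s\<close> by (intro divide_right_mono power_mono) auto
    ultimately show ?thesis
      unfolding norm_f B_def using K by (intro mult_left_mono) auto
  qed
  have B_eq: "B u = (1 / sqrt (2 * pi) * exp (\<theta>\<^sup>2 / (2 * s\<^sup>2))) * (normal_density \<mu> s u * exp (- 1 / 2 * u))" for u
  proof -
    have "B u = K * exp (- (u - \<mu>)\<^sup>2 / (2 * s\<^sup>2) + \<theta>\<^sup>2 / (2 * s\<^sup>2) + - 1 / 2 * u)"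
      by (simp add: B_def)
    then show ?thesis by (simp only: K_def normal_density_def exp_add mult_ac)
  qed
  have B_int: "integrable lborel B"
    unfolding B_eq[abs_def] by (intro integrable_mult_right integrable_normal_density_exp \<open>0 < s\<close>)
  \<comment> \<open>In terms of the positive constant \<open>1 / (2 * s\<^sup>2)\<close> the limits of \<open>B\<close> are within reach of
    asymptotic automation.\<close>
  define \<kappa> where "\<kappa> = 1 / (2 * s\<^sup>2)"
  have "0 < \<kappa>" using \<open>0 < s\<close> by (simp add: \<kappa>_def)
  have B_kap: "B u = K * exp (- (\<kappa> * (u - \<mu>)\<^sup>2) + \<theta>\<^sup>2 * \<kappa> - u / 2)" for u by (simp add: B_def \<kappa>_def)
  have B_lim: "(B \<longlongrightarrow> 0) at_top" "(B \<longlongrightarrow> 0) at_bot"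
    unfolding B_kap[abs_def] using \<open>0 < \<kappa>\<close> by real_asymp+
  have holo: "f holomorphic_on UNIV"
    unfolding f_def[abs_def] using \<open>0 < s\<close> by (intro holomorphic_intros) auto
  have meas: "(\<lambda>u. f (Complex u \<tau>)) \<in> borel_measurable lborel" for \<tau>
  proof -
    have "continuous_on UNIV (\<lambda>u. f (Complex u \<tau>))"
      by (intro continuous_on_compose2[OF holomorphic_on_imp_continuous_on[OF holo]] continuous_intros) auto
    then show ?thesis by (simp add: borel_measurable_continuous_onI)
  qed
  have int: "integrable lborel (\<lambda>u. f (Complex u \<tau>))" if "0 \<le> \<tau>" "\<tau> \<le> \<theta>" for \<tau>
    by (rule Bochner_Integration.integrable_bound[OF B_int meas])
      (use f_le[OF that] order_trans[OF _ abs_ge_self] in auto)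
  have "(\<integral>u. f (of_real u) \<partial>lborel) = (\<integral>u. f (Complex u \<theta>) \<partial>lborel)"
  proof (rule integral_shift_contour[OF holo \<open>0 \<le> \<theta>\<close> _ int f_le B_lim])
    have "complex_of_real u = Complex u 0" for u by (simp add: complex_eq_iff)
    then show "integrable lborel (\<lambda>u. f (of_real u))" using int[of 0] \<open>0 \<le> \<theta>\<close> by simp
  qed (use \<open>0 \<le> \<theta>\<close> in auto)
  then have "cmod (\<integral>u. f (of_real u) \<partial>lborel) \<le> (\<integral>u. cmod (f (Complex u \<theta>)) \<partial>lborel)"
    by simp
  also have "\<dots> = (\<integral>u. cmod (f (Complex (u - a) \<theta>)) \<partial>lborel)"
    by (subst lborel_integral_real_affine[where c = 1 and t = "- a"]) (auto simp: algebra_simps)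
  also have "\<dots> = (\<integral>u. exp (\<theta>\<^sup>2 / (2 * s\<^sup>2) - V * \<theta> + a / 2) *
      (normal_density (\<mu> + a) s u * normal_density 0 (exp (u / 2)) y) \<partial>lborel)"
  proof (rule Bochner_Integration.integral_cong[OF refl])
    fix u :: real
    have "exp (- (u - a)) * cos \<theta> = exp (- u)"
      unfolding a[symmetric] by (simp flip: exp_add)
    then have "cmod (f (Complex (u - a) \<theta>))
      = K * exp (- (u - a - \<mu>)\<^sup>2 / (2 * s\<^sup>2) + \<theta>\<^sup>2 / (2 * s\<^sup>2) - V * \<theta> - (u - a) / 2 - y\<^sup>2 / 2 * exp (- u))"
      unfolding norm_f by simp
    also have "- (u - a - \<mu>)\<^sup>2 / (2 * s\<^sup>2) + \<theta>\<^sup>2 / (2 * s\<^sup>2) - V * \<theta> - (u - a) / 2 - y\<^sup>2 / 2 * exp (- u)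
       = (\<theta>\<^sup>2 / (2 * s\<^sup>2) - V * \<theta> + a / 2) + (- (u - (\<mu> + a))\<^sup>2 / (2 * s\<^sup>2) + (- (u / 2) - y\<^sup>2 / 2 * exp (- u)))"
      by (simp add: field_simps)
    finally show "cmod (f (Complex (u - a) \<theta>)) = exp (\<theta>\<^sup>2 / (2 * s\<^sup>2) - V * \<theta> + a / 2) *
      (normal_density (\<mu> + a) s u * normal_density 0 (exp (u / 2)) y)"
      by (simp only: exp_add normal_density_exp_half normal_density_def[of "\<mu> + a"] K_def mult_ac)
  qed
  also have "\<dots> = exp (\<theta>\<^sup>2 / (2 * s\<^sup>2) - V * \<theta> + a / 2) * exp_mixture (normal_density (\<mu> + a) s) y"
    by (simp add: exp_mixture_def)
  finally show ?thesis by (simp add: f_real)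
qed

section \<open>The two hypotheses\<close>

text \<open>For \<open>\<delta> = 0\<close> this is a mixture of two Gaussians; the one centred at \<open>\<mu> + a\<close> has the small weight \<open>\<kappa>\<close>
and dominates, after mixing with the normal kernels, the effect of the perturbation. The sine is odd
about \<open>\<mu>\<close>, so the total mass does not change with \<open>\<delta>\<close>.\<close>

definition oscillating_hypothesis ::
    "real \<Rightarrow> real \<Rightarrow> real \<Rightarrow> real \<Rightarrow> real \<Rightarrow> real \<Rightarrow> real \<Rightarrow> real" where
  "oscillating_hypothesis \<mu> s a \<kappa> V \<delta> u =
     (1 - \<kappa>) * normal_density \<mu> s u + \<kappa> * normal_density (\<mu> + a) s u
     + \<delta> * (normal_density \<mu> s u * sin (V * (u - \<mu>)))"

lemma integrable_normal_sin:
  assumes "integrable lborel (\<lambda>u. normal_density \<mu> s u * h u)" and [measurable]: "h \<in> borel_measurable borel"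
  shows "integrable lborel (\<lambda>u. normal_density \<mu> s u * sin (V * (u - \<mu>)) * h u)"
  by (rule Bochner_Integration.integrable_bound[OF assms(1)])
    (auto simp: abs_mult intro!: mult_right_mono mult_left_le)

lemma integral_normal_sin:
  assumes "0 < s"
  shows "(\<integral>u. normal_density \<mu> s u * sin (V * (u - \<mu>)) \<partial>lborel) = 0"
proof -
  have "(\<integral>u. complex_of_real (normal_density \<mu> s u) * iexp (V * (u - \<mu>)) \<partial>lborel)
      = (\<integral>u. iexp (- V * \<mu>) * (complex_of_real (normal_density \<mu> s u) * iexp (V * u)) \<partial>lborel)"
    by (intro Bochner_Integration.integral_cong refl) (simp add: algebra_simps exp_diff exp_minus field_simps)
  also have "\<dots> = iexp (- V * \<mu>) * (iexp (V * \<mu>) * of_real (exp (- (s\<^sup>2 * V\<^sup>2 / 2))))"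
    by (simp only: integral_mult_right_zero char_normal_density[OF assms])
  also have "\<dots> = of_real (exp (- (s\<^sup>2 * V\<^sup>2 / 2)))"
    by (simp add: exp_minus field_simps)
  finally have "Im (\<integral>u. complex_of_real (normal_density \<mu> s u) * iexp (V * (u - \<mu>)) \<partial>lborel) = 0"
    by simp
  moreover have "integrable lborel (\<lambda>u. complex_of_real (normal_density \<mu> s u) * iexp (V * (u - \<mu>)))"
    by (rule Bochner_Integration.integrable_bound[OF integrable_normal_density[OF assms, of \<mu>]]) (auto simp: norm_mult)
  ultimately show ?thesis
    by (simp flip: integral_Im add: Im_exp)
qed

lemma exp_mixture_normal_pos:
  assumes "0 < s"
  shows "0 < exp_mixture (normal_density \<mu> s) y"
proof -
  let ?f = "\<lambda>u. normal_density \<mu> s u * normal_density 0 (exp (u / 2)) y"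
  have pos: "0 < ?f u" for u using assms by (simp add: normal_density_pos)
  have "\<not> (AE u in lborel. ?f u = 0)"
  proof
    assume "AE u in lborel. ?f u = 0"
    then have "AE u in (lborel :: real measure). False"
      by (rule eventually_mono) (metis pos less_irrefl)
    then show False by (simp add: eventually_False ae_filter_eq_bot_iff)
  qed
  moreover have "integral\<^sup>L lborel ?f = 0 \<longleftrightarrow> (AE u in lborel. ?f u = 0)"
    using pos by (intro integral_nonneg_eq_0_iff_AE integrable_normal_mixture assms) (auto intro: less_imp_le)
  moreover have "0 \<le> integral\<^sup>L lborel ?f"
    using pos by (intro Bochner_Integration.integral_nonneg less_imp_le)
  ultimately show ?thesis by (simp add: exp_mixture_def less_le)
qed

lemma exp_mixture_oscillating_hypothesis:
  assumes "0 < s"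
  shows "integrable lborel (\<lambda>u. oscillating_hypothesis \<mu> s a \<kappa> V \<delta> u * normal_density 0 (exp (u / 2)) y)"
    and "exp_mixture (oscillating_hypothesis \<mu> s a \<kappa> V \<delta>) y
      = (1 - \<kappa>) * exp_mixture (normal_density \<mu> s) y + \<kappa> * exp_mixture (normal_density (\<mu> + a) s) y
        + \<delta> * exp_mixture (\<lambda>u. normal_density \<mu> s u * sin (V * (u - \<mu>))) y"
proof -
  let ?N = "\<lambda>u. normal_density 0 (exp (u / 2)) y"
  have eq: "(\<lambda>u. oscillating_hypothesis \<mu> s a \<kappa> V \<delta> u * ?N u) = (\<lambda>u. (1 - \<kappa>) * (normal_density \<mu> s u * ?N u)
      + \<kappa> * (normal_density (\<mu> + a) s u * ?N u) + \<delta> * (normal_density \<mu> s u * sin (V * (u - \<mu>)) * ?N u))"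
    by (simp add: oscillating_hypothesis_def algebra_simps)
  have [measurable]: "?N \<in> borel_measurable borel" unfolding normal_density_def by measurable
  have i: "integrable lborel (\<lambda>u. normal_density \<nu> s u * ?N u)" for \<nu>
    using assms by (rule integrable_normal_mixture)
  have "integrable lborel (\<lambda>u. normal_density \<mu> s u * sin (V * (u - \<mu>)) * ?N u)"
    using i by (rule integrable_normal_sin) measurable
  note i' = i this
  show "integrable lborel (\<lambda>u. oscillating_hypothesis \<mu> s a \<kappa> V \<delta> u * ?N u)"
    unfolding eq by (intro Bochner_Integration.integrable_add integrable_mult_right i')
  show "exp_mixture (oscillating_hypothesis \<mu> s a \<kappa> V \<delta>) y
      = (1 - \<kappa>) * exp_mixture (normal_density \<mu> s) y + \<kappa> * exp_mixture (normal_density (\<mu> + a) s) y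
        + \<delta> * exp_mixture (\<lambda>u. normal_density \<mu> s u * sin (V * (u - \<mu>))) y"
  proof -
    note j = integrable_mult_right[OF i[of \<mu>], of "1 - \<kappa>"] integrable_mult_right[OF i[of "\<mu> + a"], of \<kappa>]
      integrable_mult_right[OF i'(2), of \<delta>]
    show ?thesis
      unfolding exp_mixture_def eq Bochner_Integration.integral_add[OF Bochner_Integration.integrable_add[OF j(1,2)] j(3)]
        Bochner_Integration.integral_add[OF j(1,2)] integral_mult_right_zero ..
  qed
qed

lemma log_time_density_oscillating_hypothesis:
  assumes "0 < s" "0 \<le> \<kappa>" "0 \<le> \<delta>" "\<delta> \<le> 1 - \<kappa>"
  shows "log_time_density (oscillating_hypothesis \<mu> s a \<kappa> V \<delta>)"
proof
  have i: "integrable lborel (\<lambda>u. normal_density \<mu> s u * sin (V * (u - \<mu>)))"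
    using integrable_normal_sin[of \<mu> s "\<lambda>_. 1" V] assms(1) by simp
  show "continuous_on UNIV (oscillating_hypothesis \<mu> s a \<kappa> V \<delta>)"
    using assms(1) unfolding oscillating_hypothesis_def[abs_def] normal_density_def
    by (intro continuous_intros) auto
  show "0 \<le> oscillating_hypothesis \<mu> s a \<kappa> V \<delta> u" for u
  proof -
    have "- \<delta> \<le> \<delta> * sin (V * (u - \<mu>))"
      using mult_left_mono[OF sin_ge_minus_one[of "V * (u - \<mu>)"] \<open>0 \<le> \<delta>\<close>] by simp
    then have "0 \<le> (1 - \<kappa>) + \<delta> * sin (V * (u - \<mu>))" using assms by linarith
    then have "0 \<le> normal_density \<mu> s u * ((1 - \<kappa>) + \<delta> * sin (V * (u - \<mu>))) + \<kappa> * normal_density (\<mu> + a) s u"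
      using mult_nonneg_nonneg[OF normal_density_nonneg[of \<mu> s u]]
        mult_nonneg_nonneg[OF \<open>0 \<le> \<kappa>\<close> normal_density_nonneg[of "\<mu> + a" s u]] by auto
    then show ?thesis by (simp add: oscillating_hypothesis_def algebra_simps)
  qed
  show "integrable lborel (oscillating_hypothesis \<mu> s a \<kappa> V \<delta>)"
    unfolding oscillating_hypothesis_def[abs_def]
    by (intro Bochner_Integration.integrable_add integrable_mult_right i integrable_normal_density assms)
  show "(\<integral>u. oscillating_hypothesis \<mu> s a \<kappa> V \<delta> u \<partial>lborel) = 1"
    unfolding oscillating_hypothesis_def using i assms(1) by (simp add: integral_normal_sin)
  show "integrable lborel (\<lambda>u. oscillating_hypothesis \<mu> s a \<kappa> V \<delta> u * normal_density 0 (exp (u / 2)) y)" for y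
    using assms(1) by (rule exp_mixture_oscillating_hypothesis)
qed

text \<open>The sine is the imaginary part of the complex oscillation.\<close>

lemma exp_mixture_sin_bound:
  assumes "0 < s" "0 \<le> V" "0 \<le> \<theta>" "\<theta> < pi / 2" "exp (- a) = cos \<theta>"
  shows "\<bar>exp_mixture (\<lambda>u. normal_density \<mu> s u * sin (V * (u - \<mu>))) y\<bar>
    \<le> exp (\<theta>\<^sup>2 / (2 * s\<^sup>2) - V * \<theta> + a / 2) * exp_mixture (normal_density (\<mu> + a) s) y"
proof -
  let ?F = "\<lambda>u. complex_of_real (normal_density \<mu> s u * normal_density 0 (exp (u / 2)) y) * iexp (V * (u - \<mu>))"
  have [measurable]: "(\<lambda>u. normal_density 0 (exp (u / 2)) y) \<in> borel_measurable borel"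
    unfolding normal_density_def by measurable
  have "integrable lborel ?F"
    by (intro Bochner_Integration.integrable_bound[OF integrable_normal_mixture[OF assms(1), of \<mu> y]])
      (auto simp: norm_mult)
  then have "exp_mixture (\<lambda>u. normal_density \<mu> s u * sin (V * (u - \<mu>))) y = Im (\<integral>u. ?F u \<partial>lborel)"
    unfolding exp_mixture_def
    by (subst integral_Im[symmetric]) (auto simp: Im_exp mult_ac intro!: Bochner_Integration.integral_cong)
  then show ?thesis
    using order_trans[OF abs_Im_le_cmod oscillating_mixture_bound[OF assms]] by (simp only:)
qed

lemma mellin_normal_density:
  assumes "0 < s"
  shows "integrable lborel (\<lambda>u. complex_of_real (normal_density \<mu> s u * exp (c * u)) * iexp (v * u))"
    and "cmod (\<integral>u. complex_of_real (normal_density \<mu> s u * exp (c * u)) * iexp (v * u) \<partial>lborel)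
      = exp (c * \<mu> + c\<^sup>2 * s\<^sup>2 / 2) * exp (- (s\<^sup>2 * v\<^sup>2 / 2))"
proof -
  show "integrable lborel (\<lambda>u. complex_of_real (normal_density \<mu> s u * exp (c * u)) * iexp (v * u))"
    by (rule Bochner_Integration.integrable_bound[OF integrable_normal_density_exp[OF assms, of \<mu> c]])
      (auto simp: norm_mult)
  have "(\<integral>u. complex_of_real (normal_density \<mu> s u * exp (c * u)) * iexp (v * u) \<partial>lborel)
      = of_real (exp (c * \<mu> + c\<^sup>2 * s\<^sup>2 / 2)) *
        (iexp (v * (\<mu> + c * s\<^sup>2)) * of_real (exp (- (s\<^sup>2 * v\<^sup>2 / 2))))"
  proof -
    have "complex_of_real (normal_density \<mu> s u * exp (c * u)) * iexp (v * u)
        = of_real (exp (c * \<mu> + c\<^sup>2 * s\<^sup>2 / 2)) *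
          (of_real (normal_density (\<mu> + c * s\<^sup>2) s u) * iexp (v * u))" for u
      unfolding normal_density_tilt[OF assms] by simp
    then show ?thesis
      by (simp only: integral_mult_right_zero char_normal_density[OF assms])
  qed
  then show "cmod (\<integral>u. complex_of_real (normal_density \<mu> s u * exp (c * u)) * iexp (v * u) \<partial>lborel)
      = exp (c * \<mu> + c\<^sup>2 * s\<^sup>2 / 2) * exp (- (s\<^sup>2 * v\<^sup>2 / 2))"
    by (simp only: norm_mult norm_of_real norm_exp_i_times abs_exp_cancel mult_1)
qed

text \<open>The choice of \<open>\<mu>\<close> makes the Mellin transform of the Gaussian centred at \<open>\<mu>\<close> have modulus exactly \<open>g v\<close>
on the line, for every \<open>\<gamma>\<close> and \<open>s\<close>: tilting by \<open>exp ((\<gamma> - 1) * u)\<close> changes the mean to \<open>- \<mu>\<close> and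
leaves the total mass equal to \<open>1\<close>. The component centred at \<open>\<mu> + a\<close> acquires the factor
\<open>exp ((\<gamma> - 1) * a)\<close>, which its weight \<open>\<kappa>\<close> compensates. Multiplication by the sine splits the transform
into two copies shifted by \<open>\<plusminus>V\<close>.\<close>

lemma mellin_oscillating_hypothesis:
  fixes V :: real
  assumes "0 < s" "0 \<le> a" "0 \<le> \<gamma>" "0 \<le> \<delta>"
    and \<mu>: "\<mu> = - (s\<^sup>2 * (\<gamma> - 1) / 2)" and \<kappa>: "\<kappa> = exp (- (a * \<gamma>)) / 2"
  defines "b \<equiv> oscillating_hypothesis \<mu> s a \<kappa> V \<delta>"
    and "g \<equiv> \<lambda>v. exp (- (s\<^sup>2 * v\<^sup>2 / 2))"
  shows "mellin_exists_on_line (exp_density b) \<gamma>"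
    and "cmod (mellin (exp_density b) (Complex \<gamma> v)) \<le> 2 * g v + \<delta> / 2 * (g (v + V) + g (v - V))"
proof -
  let ?e = "\<lambda>u. exp ((\<gamma> - 1) * u)"
  let ?X = "\<lambda>\<nu> v u. complex_of_real (normal_density \<nu> s u * ?e u) * iexp (v * u)"
  have b_meas: "b \<in> borel_measurable borel"
    unfolding b_def oscillating_hypothesis_def[abs_def] by measurable
  have b_eq: "b u * ?e u = (1 - \<kappa>) * (normal_density \<mu> s u * ?e u)
      + \<kappa> * (normal_density (\<mu> + a) s u * ?e u) + \<delta> * (normal_density \<mu> s u * sin (V * (u - \<mu>)) * ?e u)" for u
    by (simp add: b_def oscillating_hypothesis_def algebra_simps)
  have b_int: "integrable lborel (\<lambda>u. b u * ?e u)"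
  proof -
    have "integrable lborel (\<lambda>u. normal_density \<mu> s u * sin (V * (u - \<mu>)) * ?e u)"
      using integrable_normal_density_exp[OF assms(1)] by (rule integrable_normal_sin) measurable
    then show ?thesis
      using assms(1) by (simp add: b_eq integrable_normal_density_exp)
  qed
  show "mellin_exists_on_line (exp_density b) \<gamma>"
    using b_meas b_int by (rule mellin_exp_density)
  let ?c = "\<lambda>w. iexp w / (2 * \<i>)"
  have pw: "complex_of_real (b u * ?e u) * iexp (v * u)
      = of_real (1 - \<kappa>) * ?X \<mu> v u + of_real \<kappa> * ?X (\<mu> + a) v u
        + of_real \<delta> * (?c (- (V * \<mu>)) * ?X \<mu> (v + V) u - ?c (V * \<mu>) * ?X \<mu> (v - V) u)" for u
  proof -
    have "complex_of_real (sin (V * (u - \<mu>))) = (iexp (V * (u - \<mu>)) - iexp (- (V * (u - \<mu>)))) / (2 * \<i>)"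
      by (simp add: sin_of_real[symmetric] sin_exp_eq)
    then have "complex_of_real (sin (V * (u - \<mu>))) * iexp (v * u)
        = (iexp (V * (u - \<mu>)) * iexp (v * u) - iexp (- (V * (u - \<mu>))) * iexp (v * u)) / (2 * \<i>)"
      by (simp only: left_diff_distrib times_divide_eq_left)
    also have "iexp (V * (u - \<mu>)) * iexp (v * u) = iexp (- (V * \<mu>)) * iexp ((v + V) * u)"
      by (simp only: exp_add[symmetric] distrib_left[symmetric] of_real_add[symmetric])
        (simp add: algebra_simps)
    also have "iexp (- (V * (u - \<mu>))) * iexp (v * u) = iexp (V * \<mu>) * iexp ((v - V) * u)"
      by (simp only: exp_add[symmetric] distrib_left[symmetric] of_real_add[symmetric])
        (simp add: algebra_simps)
    finally have sin_eq: "complex_of_real (sin (V * (u - \<mu>))) * iexp (v * u)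
        = ?c (- (V * \<mu>)) * iexp ((v + V) * u) - ?c (V * \<mu>) * iexp ((v - V) * u)"
      by (simp only: diff_divide_distrib times_divide_eq_left)
    have N: "N * (c * E - c' * E') = c * (N * E) - c' * (N * E')" for N c c' E E' :: complex
      by (simp add: algebra_simps)
    have "complex_of_real (b u * ?e u) * iexp (v * u)
      = of_real (1 - \<kappa>) * ?X \<mu> v u + of_real \<kappa> * ?X (\<mu> + a) v u
        + of_real \<delta> * (complex_of_real (normal_density \<mu> s u * ?e u) * (complex_of_real (sin (V * (u - \<mu>))) * iexp (v * u)))"
      unfolding b_eq by (simp only: of_real_add of_real_mult distrib_right) (simp only: mult_ac)
    then show ?thesis unfolding sin_eq N .
  qed
  have norm_comb: "cmod (of_real p * X + of_real q * Y + of_real d * (c * Z - c' * Z'))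
      \<le> \<bar>p\<bar> * cmod X + \<bar>q\<bar> * cmod Y + \<bar>d\<bar> * (1 / 2 * cmod Z + 1 / 2 * cmod Z')"
    if "cmod c = 1 / 2" "cmod c' = 1 / 2" for p q d :: real and c c' X Y Z Z' :: complex
  proof -
    have "cmod (c * Z - c' * Z') \<le> 1 / 2 * cmod Z + 1 / 2 * cmod Z'"
      using norm_triangle_ineq4[of "c * Z" "c' * Z'"] that by (simp add: norm_mult)
    from mult_left_mono[OF this abs_ge_zero[of d]]
    have "cmod (of_real d * (c * Z - c' * Z')) \<le> \<bar>d\<bar> * (1 / 2 * cmod Z + 1 / 2 * cmod Z')"
      by (simp add: norm_mult)
    moreover have "cmod (of_real p * X + of_real q * Y) \<le> \<bar>p\<bar> * cmod X + \<bar>q\<bar> * cmod Y"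
      using norm_triangle_ineq[of "of_real p * X" "of_real q * Y"] by (simp add: norm_mult)
    ultimately show ?thesis by (rule norm_triangle_mono[rotated])
  qed
  have integral_comb: "(\<integral>u. p * f1 u + q * f2 u + d * (c * f3 u - c' * f4 u) \<partial>lborel)
      = p * integral\<^sup>L lborel f1 + q * integral\<^sup>L lborel f2
        + d * (c * integral\<^sup>L lborel f3 - c' * integral\<^sup>L lborel f4)"
    if "integrable lborel f1" "integrable lborel f2" "integrable lborel f3" "integrable lborel f4"
    for p q d c c' :: complex and f1 f2 f3 f4 :: "real \<Rightarrow> complex"
  proof -
    have i: "integrable lborel (\<lambda>u. p * f1 u)" "integrable lborel (\<lambda>u. q * f2 u)"
      "integrable lborel (\<lambda>u. c * f3 u)" "integrable lborel (\<lambda>u. c' * f4 u)"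
      using that by (intro integrable_mult_right; simp)+
    have j: "integrable lborel (\<lambda>u. d * (c * f3 u - c' * f4 u))"
      using Bochner_Integration.integrable_diff[OF i(3,4)] by (intro integrable_mult_right)
    show ?thesis
      unfolding Bochner_Integration.integral_add[OF Bochner_Integration.integrable_add[OF i(1,2)] j]
        Bochner_Integration.integral_add[OF i(1,2)] integral_mult_right_zero
        Bochner_Integration.integral_diff[OF i(3,4)] ..
  qed
  let ?I = "\<lambda>\<nu> v. \<integral>u. ?X \<nu> v u \<partial>lborel"
  have int: "integrable lborel (?X \<nu> v)" for \<nu> v by (rule mellin_normal_density[OF assms(1)])
  have mellin_eq: "mellin (exp_density b) (Complex \<gamma> v) = of_real (1 - \<kappa>) * ?I \<mu> v + of_real \<kappa> * ?I (\<mu> + a) v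
        + of_real \<delta> * (?c (- (V * \<mu>)) * ?I \<mu> (v + V) - ?c (V * \<mu>) * ?I \<mu> (v - V))"
  proof -
    have "mellin (exp_density b) (Complex \<gamma> v)
        = (\<integral>u. complex_of_real (b u * ?e u) * iexp (v * u) \<partial>lborel)"
      by (rule mellin_exp_density(2)[OF b_meas b_int])
    also have "\<dots> = (\<integral>u. of_real (1 - \<kappa>) * ?X \<mu> v u + of_real \<kappa> * ?X (\<mu> + a) v u
        + of_real \<delta> * (?c (- (V * \<mu>)) * ?X \<mu> (v + V) u - ?c (V * \<mu>) * ?X \<mu> (v - V) u) \<partial>lborel)"
      by (rule Bochner_Integration.integral_cong[OF refl pw])
    also have "\<dots> = of_real (1 - \<kappa>) * ?I \<mu> v + of_real \<kappa> * ?I (\<mu> + a) v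
        + of_real \<delta> * (?c (- (V * \<mu>)) * ?I \<mu> (v + V) - ?c (V * \<mu>) * ?I \<mu> (v - V))"
      by (rule integral_comb) (rule int)+
    finally show ?thesis .
  qed
  have "cmod (mellin (exp_density b) (Complex \<gamma> v)) \<le> \<bar>1 - \<kappa>\<bar> * cmod (?I \<mu> v) + \<bar>\<kappa>\<bar> * cmod (?I (\<mu> + a) v)
      + \<bar>\<delta>\<bar> * (1 / 2 * cmod (?I \<mu> (v + V)) + 1 / 2 * cmod (?I \<mu> (v - V)))"
    unfolding mellin_eq by (rule norm_comb) (simp_all only: norm_divide norm_exp_i_times, simp_all)
  also have "\<dots> = \<bar>1 - \<kappa>\<bar> * g v + \<bar>\<kappa>\<bar> * exp ((\<gamma> - 1) * a) * g v + \<bar>\<delta>\<bar> / 2 * (g (v + V) + g (v - V))"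
  proof -
    have c0: "(\<gamma> - 1) * \<mu> + (\<gamma> - 1)\<^sup>2 * s\<^sup>2 / 2 = 0"
      unfolding \<mu> by (simp add: power2_eq_square)
    then have ca: "(\<gamma> - 1) * (\<mu> + a) + (\<gamma> - 1)\<^sup>2 * s\<^sup>2 / 2 = (\<gamma> - 1) * a"
      by (simp only: distrib_left)
    have "cmod (?I \<mu> w) = g w" for w
      by (simp only: mellin_normal_density(2)[OF assms(1)] c0 exp_zero mult_1 g_def)
    moreover have "cmod (?I (\<mu> + a) v) = exp ((\<gamma> - 1) * a) * g v"
      by (simp only: mellin_normal_density(2)[OF assms(1)] ca g_def)
    ultimately show ?thesis
      by (simp only: mult.assoc distrib_left)
  qed
  also have "\<dots> \<le> 2 * g v + \<delta> / 2 * (g (v + V) + g (v - V))"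
  proof -
    have "0 \<le> a * \<gamma>" using assms by simp
    then have "exp (- (a * \<gamma>)) \<le> 1" by simp
    then have k: "0 < \<kappa>" "\<kappa> \<le> 1" unfolding \<kappa> by (simp, linarith)
    have "- (a * \<gamma>) + (\<gamma> - 1) * a = - a" by (simp add: algebra_simps)
    then have "\<kappa> * exp ((\<gamma> - 1) * a) = exp (- a) / 2"
      unfolding \<kappa> by (simp only: times_divide_eq_left exp_add[symmetric])
    also have "\<dots> \<le> 1 / 2" using assms by simp
    finally have "\<bar>1 - \<kappa>\<bar> + \<bar>\<kappa>\<bar> * exp ((\<gamma> - 1) * a) \<le> 2" using k by simp
    then have "(\<bar>1 - \<kappa>\<bar> + \<bar>\<kappa>\<bar> * exp ((\<gamma> - 1) * a)) * g v \<le> 2 * g v"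
      by (rule mult_right_mono) (simp add: g_def)
    from add_right_mono[OF this, of "\<delta> / 2 * (g (v + V) + g (v - V))"]
    show ?thesis by (simp only: distrib_right abs_of_nonneg[OF \<open>0 \<le> \<delta>\<close>])
  qed
  finally show "cmod (mellin (exp_density b) (Complex \<gamma> v)) \<le> 2 * g v + \<delta> / 2 * (g (v + V) + g (v - V))" .
qed

text \<open>The bound decreases like \<open>1 / s\<close>. This is why a wide Gaussian satisfies the constraint of the class
however small \<open>L\<close> is.\<close>

lemma nn_integral_gaussian_exp_abs:
  assumes "0 < s" "0 \<le> \<beta>"
  shows "(\<integral>\<^sup>+v. ennreal (exp (- (s\<^sup>2 * v\<^sup>2 / 2)) * exp (\<beta> * \<bar>v\<bar>)) \<partial>lborel)
    \<le> ennreal (2 * (sqrt (2 * pi) / s * exp (\<beta>\<^sup>2 / (2 * s\<^sup>2))))"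
proof -
  define A where "A = sqrt (2 * pi) / s"
  have A: "0 \<le> A" using assms by (simp add: A_def)
  have g: "exp (- (s\<^sup>2 * v\<^sup>2 / 2)) = A * normal_density 0 (1 / s) v" for v
    using assms by (simp add: A_def normal_density_def real_sqrt_mult real_sqrt_divide field_simps)
  have tilt: "exp (- (s\<^sup>2 * v\<^sup>2 / 2)) * exp (c * v)
      = A * exp (c\<^sup>2 / (2 * s\<^sup>2)) * normal_density (c * (1 / s)\<^sup>2) (1 / s) v" for c v
    using normal_density_tilt[of "1 / s" 0 v c] assms unfolding g by (simp add: power_divide)
  have one: "(\<integral>\<^sup>+v. ennreal (exp (- (s\<^sup>2 * v\<^sup>2 / 2)) * exp (c * v)) \<partial>lborel)
      = ennreal (A * exp (c\<^sup>2 / (2 * s\<^sup>2)))" for c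
    unfolding tilt using A assms
    by (subst nn_integral_eq_integral) (auto intro!: integrable_mult_right)
  have "(\<integral>\<^sup>+v. ennreal (exp (- (s\<^sup>2 * v\<^sup>2 / 2)) * exp (\<beta> * \<bar>v\<bar>)) \<partial>lborel)
      \<le> (\<integral>\<^sup>+v. ennreal (exp (- (s\<^sup>2 * v\<^sup>2 / 2)) * exp (\<beta> * v)) + ennreal (exp (- (s\<^sup>2 * v\<^sup>2 / 2)) * exp (- \<beta> * v)) \<partial>lborel)"
  proof (rule nn_integral_mono)
    fix v :: real
    have "exp (\<beta> * \<bar>v\<bar>) \<le> exp (\<beta> * v) + exp (- \<beta> * v)" by (simp add: abs_if)
    then have "exp (- (s\<^sup>2 * v\<^sup>2 / 2)) * exp (\<beta> * \<bar>v\<bar>) \<le> exp (- (s\<^sup>2 * v\<^sup>2 / 2)) * (exp (\<beta> * v) + exp (- \<beta> * v))"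
      by (intro mult_left_mono) auto
    then show "ennreal (exp (- (s\<^sup>2 * v\<^sup>2 / 2)) * exp (\<beta> * \<bar>v\<bar>))
      \<le> ennreal (exp (- (s\<^sup>2 * v\<^sup>2 / 2)) * exp (\<beta> * v)) + ennreal (exp (- (s\<^sup>2 * v\<^sup>2 / 2)) * exp (- \<beta> * v))"
      by (simp add: distrib_left flip: ennreal_plus)
  qed
  also have "\<dots> = ennreal (A * exp (\<beta>\<^sup>2 / (2 * s\<^sup>2))) + ennreal (A * exp ((- \<beta>)\<^sup>2 / (2 * s\<^sup>2)))"
    by (subst nn_integral_add) (simp_all only: one, auto)
  also have "\<dots> = ennreal (2 * (sqrt (2 * pi) / s * exp (\<beta>\<^sup>2 / (2 * s\<^sup>2))))"
    using A assms by (simp add: A_def flip: ennreal_plus)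
  finally show ?thesis .
qed

section \<open>The lower bound at a fixed frequency\<close>

lemma arctan_le_self:
  assumes "0 \<le> y" shows "arctan y \<le> y"
proof -
  have "0 - arctan 0 \<le> y - arctan y"
  proof (rule DERIV_nonneg_imp_nondecreasing[OF assms])
    fix x :: real
    have "((\<lambda>x. x - arctan x) has_real_derivative 1 - inverse (1 + x\<^sup>2)) (at x)"
      by (auto intro!: derivative_eq_intros)
    moreover have "inverse (1 + x\<^sup>2) \<le> 1" by (simp add: inverse_le_1_iff)
    ultimately show "\<exists>D. ((\<lambda>x. x - arctan x) has_real_derivative D) (at x) \<and> 0 \<le> D"
      by (intro exI conjI) auto
  qed
  then show ?thesis by simp
qed

text \<open>Stopping the shift at \<open>arctan V\<close> instead of \<open>pi / 2\<close> costs only a constant factor in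
\<open>exp (- V * \<theta>)\<close>.\<close>

lemma frequency_times_arctan:
  assumes "0 < V" shows "pi * V / 2 - 1 \<le> V * arctan V"
proof -
  have "pi / 2 - arctan V \<le> 1 / V"
    using arctan_inverse[OF assms] arctan_le_self[of "inverse V"] assms
    by (simp add: inverse_eq_divide)
  then have "V * (pi / 2 - arctan V) \<le> V * (1 / V)" using assms by (intro mult_left_mono) auto
  then show ?thesis using assms by (simp add: algebra_simps)
qed

text \<open>The weight \<open>\<omega>\<close> stands for either of \<open>exp (\<beta> * \<bar>v\<bar>)\<close> and \<open>1 + \<bar>v\<bar> powr \<beta>\<close>. The constant \<open>K\<close> bounds its
growth under a shift by the frequency \<open>V\<close>; an amplitude \<open>\<delta> \<le> 1 / K\<close> therefore brings the two shifted
peaks back to the size of the unshifted one.\<close>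

lemma nn_integral_mellin_oscillating_hypothesis:
  assumes "0 < s" "0 \<le> a" "0 \<le> \<gamma>" "0 \<le> \<delta>" "0 \<le> \<beta>"
    and \<mu>: "\<mu> = - (s\<^sup>2 * (\<gamma> - 1) / 2)" and \<kappa>: "\<kappa> = exp (- (a * \<gamma>)) / 2"
    and \<omega>: "\<And>v. 0 \<le> \<omega> v" "\<And>v. \<omega> v \<le> exp (\<beta> * \<bar>v\<bar>)"
      "\<And>v. \<omega> v \<le> K * exp (\<beta> * \<bar>v + V\<bar>)" "\<And>v. \<omega> v \<le> K * exp (\<beta> * \<bar>v - V\<bar>)"
    and K: "\<delta> * K \<le> 1"
  shows "(\<integral>\<^sup>+v. ennreal (cmod (mellin (exp_density (oscillating_hypothesis \<mu> s a \<kappa> V \<delta>)) (Complex \<gamma> v)) * \<omega> v) \<partial>lborel)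
    \<le> ennreal (6 * (sqrt (2 * pi) / s * exp (\<beta>\<^sup>2 / (2 * s\<^sup>2))))"
proof -
  define g where "g v = exp (- (s\<^sup>2 * v\<^sup>2 / 2))" for v
  define G where "G v = g v * exp (\<beta> * \<bar>v\<bar>)" for v
  have g: "0 \<le> g v" for v by (simp add: g_def)
  have G: "0 \<le> G v" for v by (simp add: G_def g)
  have [measurable]: "G \<in> borel_measurable borel" unfolding G_def[abs_def] g_def by measurable
  let ?m = "\<lambda>v. cmod (mellin (exp_density (oscillating_hypothesis \<mu> s a \<kappa> V \<delta>)) (Complex \<gamma> v))"
  have pw: "?m v * \<omega> v \<le> 2 * G v + (1 / 2 * G (V + 1 * v) + 1 / 2 * G (- V + 1 * v))" for v
  proof -
    have shift: "\<delta> * (g w * \<omega> v) \<le> G w" if "\<omega> v \<le> K * exp (\<beta> * \<bar>w\<bar>)" for w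
    proof -
      have "\<delta> * \<omega> v \<le> \<delta> * (K * exp (\<beta> * \<bar>w\<bar>))" using that \<open>0 \<le> \<delta>\<close> by (rule mult_left_mono)
      also have "\<dots> \<le> 1 * exp (\<beta> * \<bar>w\<bar>)"
        unfolding mult.assoc[symmetric] using K by (rule mult_right_mono) simp
      finally have "g w * (\<delta> * \<omega> v) \<le> g w * (1 * exp (\<beta> * \<bar>w\<bar>))"
        using g by (rule mult_left_mono)
      then show ?thesis by (simp add: G_def mult_ac)
    qed
    have "?m v \<le> 2 * g v + \<delta> / 2 * (g (v + V) + g (v - V))"
      unfolding g_def by (rule mellin_oscillating_hypothesis(2)[OF assms(1-4) \<mu> \<kappa>])
    then have "?m v * \<omega> v \<le> (2 * g v + \<delta> / 2 * (g (v + V) + g (v - V))) * \<omega> v"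
      using \<omega>(1) by (rule mult_right_mono)
    also have "\<dots> = 2 * (g v * \<omega> v) + (1 / 2 * (\<delta> * (g (v + V) * \<omega> v)) + 1 / 2 * (\<delta> * (g (v - V) * \<omega> v)))"
      by (simp add: algebra_simps)
    also have "\<dots> \<le> 2 * G v + (1 / 2 * G (v + V) + 1 / 2 * G (v - V))"
      using shift[OF \<omega>(3)] shift[OF \<omega>(4)] mult_left_mono[OF \<omega>(2) g, of v v]
      by (intro add_mono mult_left_mono) (auto simp: G_def)
    finally show ?thesis by (simp add: add.commute)
  qed
  have G_shift: "(\<integral>\<^sup>+v. ennreal (1 / 2 * G (t + 1 * v)) \<partial>lborel) = ennreal (1 / 2) * (\<integral>\<^sup>+v. ennreal (G v) \<partial>lborel)" for t
  proof -
    have "(\<integral>\<^sup>+v. ennreal (1 / 2 * G (t + 1 * v)) \<partial>lborel) = (\<integral>\<^sup>+v. ennreal (1 / 2) * ennreal (G (t + 1 * v)) \<partial>lborel)"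
      by (intro nn_integral_cong ennreal_mult) (auto simp: G)
    also have "\<dots> = ennreal (1 / 2) * (\<integral>\<^sup>+v. ennreal (G (t + 1 * v)) \<partial>lborel)"
      by (rule nn_integral_cmult) measurable
    also have "(\<integral>\<^sup>+v. ennreal (G (t + 1 * v)) \<partial>lborel) = (\<integral>\<^sup>+v. ennreal (G v) \<partial>lborel)"
      using nn_integral_real_affine[of "\<lambda>v. ennreal (G v)" 1 t] by simp
    finally show ?thesis .
  qed
  have "(\<integral>\<^sup>+v. ennreal (?m v * \<omega> v) \<partial>lborel)
      \<le> (\<integral>\<^sup>+v. ennreal (2 * G v + (1 / 2 * G (V + 1 * v) + 1 / 2 * G (- V + 1 * v))) \<partial>lborel)"
    by (intro nn_integral_mono ennreal_leI pw)
  also have "\<dots> = (\<integral>\<^sup>+v. ennreal (2 * G v) + (ennreal (1 / 2 * G (V + 1 * v)) + ennreal (1 / 2 * G (- V + 1 * v))) \<partial>lborel)"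
    by (intro nn_integral_cong) (simp add: G)
  also have "\<dots> = (\<integral>\<^sup>+v. ennreal (2 * G v) \<partial>lborel)
      + ((\<integral>\<^sup>+v. ennreal (1 / 2 * G (V + 1 * v)) \<partial>lborel) + (\<integral>\<^sup>+v. ennreal (1 / 2 * G (- V + 1 * v)) \<partial>lborel))"
    by (simp add: nn_integral_add)
  also have "\<dots> = ennreal 2 * (\<integral>\<^sup>+v. ennreal (G v) \<partial>lborel)
      + (ennreal (1 / 2) * (\<integral>\<^sup>+v. ennreal (G v) \<partial>lborel) + ennreal (1 / 2) * (\<integral>\<^sup>+v. ennreal (G v) \<partial>lborel))"
    unfolding G_shift by (simp add: ennreal_mult'' G nn_integral_cmult)
  also have "\<dots> = ennreal 3 * (\<integral>\<^sup>+v. ennreal (G v) \<partial>lborel)"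
    unfolding distrib_right[symmetric] ennreal_plus[symmetric, OF zero_le_numeral zero_le_numeral]
    by (subst ennreal_plus[symmetric], simp, simp)+
  also have "\<dots> \<le> ennreal 3 * ennreal (2 * (sqrt (2 * pi) / s * exp (\<beta>\<^sup>2 / (2 * s\<^sup>2))))"
    unfolding G_def g_def using assms by (intro mult_left_mono nn_integral_gaussian_exp_abs) auto
  also have "\<dots> = ennreal (6 * (sqrt (2 * pi) / s * exp (\<beta>\<^sup>2 / (2 * s\<^sup>2))))"
    by (subst ennreal_mult'[symmetric]) auto
  finally show ?thesis .
qed

text \<open>The two hypotheses have amplitudes \<open>0\<close> and \<open>1 / K\<close> and are compared at \<open>x = exp (\<mu> + 1)\<close>. There the
oscillation equals \<open>sin V = 1\<close>, so that \<open>x\<close> does not depend on the frequency. The assumption \<open>info\<close>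
says that the relative perturbation of the density of \<open>W\<^sub>T\<close> is at most \<open>1 / sqrt n\<close>.\<close>

lemma (in standard_brownian_motion) minimax_at_frequency:
  fixes s \<gamma> \<beta> V K :: real and n :: nat
  assumes "0 < s" "0 < \<gamma>" "0 \<le> \<beta>" "0 < n"
    and L: "6 * (sqrt (2 * pi) / s * exp (\<beta>\<^sup>2 / (2 * s\<^sup>2))) < L"
    and \<omega>: "\<And>v. 0 \<le> \<omega> v" "\<And>v. \<omega> v \<le> exp (\<beta> * \<bar>v\<bar>)"
      "\<And>v. \<omega> v \<le> K * exp (\<beta> * \<bar>v + V\<bar>)" "\<And>v. \<omega> v \<le> K * exp (\<beta> * \<bar>v - V\<bar>)"
    and "2 \<le> K" "1 \<le> V" "sin V = 1"
  defines "\<mu> \<equiv> - (s\<^sup>2 * (\<gamma> - 1) / 2)"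
    and "C \<equiv> 2 * exp (1 + pi\<^sup>2 / (8 * s\<^sup>2)) * 2 powr (\<gamma> + 1 / 2)"
  assumes info: "real n * (C * V powr (\<gamma> + 1 / 2) * exp (- (pi * V / 2)) / K)\<^sup>2 \<le> 1"
    and sep: "2 * r \<le> normal_density 0 s 1 / exp (\<mu> + 1) / K"
    and q: "q \<in> estimators n"
  shows "1 / 8 \<le> (SUP p\<in>time_densities \<inter> {f. mellin_exists_on_line f \<gamma> \<and>
        (\<integral>\<^sup>+v. ennreal (cmod (mellin f (Complex \<gamma> v)) * \<omega> v) \<partial>lborel) < ennreal L}.
      emeasure (sample_law M W n p)
        {X \<in> space (sample_law M W n p). \<bar>p (exp (\<mu> + 1)) - q X (exp (\<mu> + 1))\<bar> \<ge> r})"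
proof -
  define \<theta> where "\<theta> = arctan V"
  define a where "a = ln (sqrt (1 + V\<^sup>2))"
  define \<kappa> where "\<kappa> = exp (- (a * \<gamma>)) / 2"
  define b where "b \<delta> = oscillating_hypothesis \<mu> s a \<kappa> V \<delta>" for \<delta>
  have root: "1 \<le> sqrt (1 + V\<^sup>2)" by simp
  then have "0 < sqrt (1 + V\<^sup>2)" by linarith
  have "0 \<le> a" unfolding a_def using root by (rule ln_ge_zero)
  have \<theta>: "0 \<le> \<theta>" "\<theta> < pi / 2" unfolding \<theta>_def using \<open>1 \<le> V\<close> by (simp, intro arctan_ubound)
  have cos: "exp (- a) = cos \<theta>"
    using \<open>0 < sqrt (1 + V\<^sup>2)\<close> by (simp only: a_def \<theta>_def cos_arctan exp_minus exp_ln inverse_eq_divide)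
  have "0 \<le> a * \<gamma>" using \<open>0 \<le> a\<close> \<open>0 < \<gamma>\<close> by simp
  then have "exp (- (a * \<gamma>)) \<le> 1" by simp
  then have \<kappa>: "0 < \<kappa>" "\<kappa> \<le> 1 / 2" unfolding \<kappa>_def by (simp, linarith)
  have K: "0 \<le> 1 / K" "1 / K \<le> 1 / 2" using \<open>2 \<le> K\<close> by (auto simp: field_simps)
  have dens: "log_time_density (b \<delta>)" if "0 \<le> \<delta>" "\<delta> \<le> 1 / K" for \<delta>
    unfolding b_def using \<open>0 < s\<close> \<kappa> K that by (intro log_time_density_oscillating_hypothesis) auto
  let ?\<P> = "time_densities \<inter> {f. mellin_exists_on_line f \<gamma> \<and>
        (\<integral>\<^sup>+v. ennreal (cmod (mellin f (Complex \<gamma> v)) * \<omega> v) \<partial>lborel) < ennreal L}"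
  have mem: "exp_density (b \<delta>) \<in> ?\<P>" if \<delta>: "0 \<le> \<delta>" "\<delta> \<le> 1 / K" for \<delta>
  proof -
    interpret log_time_density "b \<delta>" using \<delta> by (rule dens)
    have "exp_density (b \<delta>) \<in> time_densities"
      by (intro exp_density_in_time_densities continuous nonneg integrable integral_eq_1)
    moreover have "mellin_exists_on_line (exp_density (b \<delta>)) \<gamma>"
      unfolding b_def using \<open>0 < s\<close> \<open>0 \<le> a\<close> \<open>0 < \<gamma>\<close> \<delta>
      by (intro mellin_oscillating_hypothesis(1)) (auto simp: \<mu>_def \<kappa>_def)
    moreover have "(\<integral>\<^sup>+v. ennreal (cmod (mellin (exp_density (b \<delta>)) (Complex \<gamma> v)) * \<omega> v) \<partial>lborel)
        \<le> ennreal (6 * (sqrt (2 * pi) / s * exp (\<beta>\<^sup>2 / (2 * s\<^sup>2))))"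
      unfolding b_def
    proof (rule nn_integral_mellin_oscillating_hypothesis[OF \<open>0 < s\<close> \<open>0 \<le> a\<close> _ \<delta>(1) \<open>0 \<le> \<beta>\<close> _ _ \<omega>])
      show "\<delta> * K \<le> 1" using \<delta> \<open>2 \<le> K\<close> by (simp add: field_simps)
    qed (use \<open>0 < \<gamma>\<close> in \<open>auto simp: \<mu>_def \<kappa>_def\<close>)
    moreover have "ennreal (6 * (sqrt (2 * pi) / s * exp (\<beta>\<^sup>2 / (2 * s\<^sup>2)))) < ennreal L"
      using L \<open>0 < s\<close> by (intro ennreal_lessI) (auto intro: le_less_trans[rotated])
    ultimately show ?thesis by auto
  qed
  define h where "h = exp_mixture (\<lambda>u. normal_density \<mu> s u * sin (V * (u - \<mu>)))"
  have mix: "exp_mixture (b \<delta>) y = (1 - \<kappa>) * exp_mixture (normal_density \<mu> s) y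
      + \<kappa> * exp_mixture (normal_density (\<mu> + a) s) y + \<delta> * h y" for \<delta> y
    unfolding b_def h_def using \<open>0 < s\<close> by (rule exp_mixture_oscillating_hypothesis)
  have normal_pos: "0 < exp_mixture (normal_density \<nu> s) y" for \<nu> y
    using \<open>0 < s\<close> by (rule exp_mixture_normal_pos)
  \<comment> \<open>The left side is the loss factor of the contour shift; dividing by the weight \<open>\<kappa>\<close> compares it
    with the unperturbed density. Since \<open>exp a \<le> 2 * V\<close>, the factor \<open>exp (a * (\<gamma> + 1 / 2))\<close> is
    polynomial in \<open>V\<close>.\<close>
  have exponent: "exp (\<theta>\<^sup>2 / (2 * s\<^sup>2) - V * \<theta> + a / 2)
      \<le> \<kappa> * (C * V powr (\<gamma> + 1 / 2) * exp (- (pi * V / 2)))"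
  proof -
    have "\<theta>\<^sup>2 \<le> (pi / 2)\<^sup>2" using \<theta> by (intro power_mono) auto
    then have "\<theta>\<^sup>2 / (2 * s\<^sup>2) \<le> pi\<^sup>2 / (8 * s\<^sup>2)"
      using \<open>0 < s\<close> by (simp add: field_simps power2_eq_square)
    moreover have "pi * V / 2 - 1 \<le> V * \<theta>"
      unfolding \<theta>_def using \<open>1 \<le> V\<close> by (intro frequency_times_arctan) simp
    moreover have "a * (\<gamma> + 1 / 2) \<le> ln (2 * V) * (\<gamma> + 1 / 2)"
    proof (rule mult_right_mono)
      have "1 \<le> V\<^sup>2" using \<open>1 \<le> V\<close> by simp
      then have "1 + V\<^sup>2 \<le> (2 * V)\<^sup>2" by (simp add: power_mult_distrib)
      then have "sqrt (1 + V\<^sup>2) \<le> 2 * V" using \<open>1 \<le> V\<close> by (intro real_le_lsqrt) auto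
      then show "a \<le> ln (2 * V)" unfolding a_def using \<open>0 < sqrt (1 + V\<^sup>2)\<close> \<open>1 \<le> V\<close> by (subst ln_le_cancel_iff) auto
    qed (use \<open>0 < \<gamma>\<close> in simp)
    ultimately have "\<theta>\<^sup>2 / (2 * s\<^sup>2) - V * \<theta> + a / 2
        \<le> - (a * \<gamma>) + ((1 + pi\<^sup>2 / (8 * s\<^sup>2)) + ln (2 * V) * (\<gamma> + 1 / 2) + - (pi * V / 2))"
      by (simp add: algebra_simps)
    then have "exp (\<theta>\<^sup>2 / (2 * s\<^sup>2) - V * \<theta> + a / 2)
        \<le> exp (- (a * \<gamma>) + ((1 + pi\<^sup>2 / (8 * s\<^sup>2)) + ln (2 * V) * (\<gamma> + 1 / 2) + - (pi * V / 2)))"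
      by simp
    also have "\<dots> = exp (- (a * \<gamma>)) * (exp (1 + pi\<^sup>2 / (8 * s\<^sup>2)) * (2 * V) powr (\<gamma> + 1 / 2) * exp (- (pi * V / 2)))"
      using \<open>1 \<le> V\<close> by (simp only: exp_add powr_def) (simp add: mult.commute)
    also have "\<dots> = \<kappa> * (C * V powr (\<gamma> + 1 / 2) * exp (- (pi * V / 2)))"
      using \<open>1 \<le> V\<close> by (simp add: \<kappa>_def C_def powr_mult)
    finally show ?thesis .
  qed
  show ?thesis
  proof (rule two_point_minimax[where ?b0.0 = "b 0" and ?b1.0 = "b (1 / K)"])
    show "log_time_density (b 0)" "log_time_density (b (1 / K))" using K by (auto intro: dens)
    show "exp_density (b 0) \<in> ?\<P>" "exp_density (b (1 / K)) \<in> ?\<P>" using K by (auto intro!: mem simp del: Int_iff)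
    show pos: "0 < exp_mixture (b 0) y" for y
      unfolding mix using \<kappa> by (auto intro!: add_pos_pos mult_pos_pos normal_pos)
    show "\<bar>exp_mixture (b (1 / K)) y - exp_mixture (b 0) y\<bar>
        \<le> C * V powr (\<gamma> + 1 / 2) * exp (- (pi * V / 2)) / K * exp_mixture (b 0) y" for y
    proof -
      let ?D = "C * V powr (\<gamma> + 1 / 2) * exp (- (pi * V / 2))" and ?q = "exp_mixture (normal_density (\<mu> + a) s) y"
      have "0 \<le> ?D" by (simp add: C_def)
      have "\<bar>h y\<bar> \<le> exp (\<theta>\<^sup>2 / (2 * s\<^sup>2) - V * \<theta> + a / 2) * ?q"
        unfolding h_def using \<open>1 \<le> V\<close> by (intro exp_mixture_sin_bound \<open>0 < s\<close> \<theta> cos) simp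
      also have "\<dots> \<le> \<kappa> * ?D * ?q"
        by (rule mult_right_mono[OF exponent less_imp_le[OF normal_pos]])
      also have "\<dots> = ?D * (\<kappa> * ?q)" by simp
      also have "\<dots> \<le> ?D * exp_mixture (b 0) y"
      proof (rule mult_left_mono[OF _ \<open>0 \<le> ?D\<close>])
        have "0 \<le> (1 - \<kappa>) * exp_mixture (normal_density \<mu> s) y"
          using \<kappa> normal_pos by (intro mult_nonneg_nonneg less_imp_le) auto
        then show "\<kappa> * ?q \<le> exp_mixture (b 0) y" by (simp add: mix)
      qed
      finally have "1 / K * \<bar>h y\<bar> \<le> 1 / K * (?D * exp_mixture (b 0) y)"
        using K(1) by (rule mult_left_mono)
      moreover have "exp_mixture (b (1 / K)) y - exp_mixture (b 0) y = 1 / K * h y" by (simp add: mix)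
      ultimately show ?thesis using \<open>2 \<le> K\<close> by (simp add: abs_mult)
    qed
    show "2 * r \<le> \<bar>exp_density (b (1 / K)) (exp (\<mu> + 1)) - exp_density (b 0) (exp (\<mu> + 1))\<bar>"
    proof -
      have "normal_density \<mu> s (\<mu> + 1) = normal_density 0 s 1" by (simp add: normal_density_def)
      then have "b (1 / K) (\<mu> + 1) - b 0 (\<mu> + 1) = normal_density 0 s 1 / K"
        by (simp add: b_def oscillating_hypothesis_def \<open>sin V = 1\<close>)
      then have "exp_density (b (1 / K)) (exp (\<mu> + 1)) - exp_density (b 0) (exp (\<mu> + 1))
          = normal_density 0 s 1 / K / exp (\<mu> + 1)"
        by (simp add: diff_divide_distrib[symmetric])
      then show ?thesis using sep \<open>2 \<le> K\<close> by (simp add: mult.commute)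
    qed
  qed (use \<open>0 < n\<close> info q in auto)
qed

section \<open>The choice of the frequency\<close>

text \<open>The admissible frequencies \<open>pi / 2 + 2 * pi * k\<close> are spaced by \<open>2 * pi\<close>, so rounding a desired frequency
up to one of them changes the rates by constant factors only.\<close>

lemma exists_frequency:
  fixes w :: real
  obtains V where "sin V = 1" "w \<le> V" "V \<le> w + 2 * pi"
proof
  define k where "k = \<lceil>(w - pi / 2) / (2 * pi)\<rceil>"
  show "sin (pi / 2 + 2 * pi * of_int k) = 1"
    by (simp add: sin_add)
  have "(w - pi / 2) / (2 * pi) \<le> of_int k" "of_int k \<le> (w - pi / 2) / (2 * pi) + 1"
    unfolding k_def by linarith+
  then show "w \<le> pi / 2 + 2 * pi * of_int k" "pi / 2 + 2 * pi * of_int k \<le> w + 2 * pi"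
    by (auto simp: field_simps)
qed

lemma ln_real_at_top: "filterlim (\<lambda>n. ln (real n)) at_top sequentially"
  by (rule filterlim_compose[OF ln_at_top filterlim_real_sequentially])

context standard_brownian_motion
begin

text \<open>The desired frequency \<open>w\<close> solves \<open>exp (- (pi + 2 * \<beta>) * w) = 1 / (n * ln n powr (2 * \<gamma> + 2))\<close>. The
logarithmic factor absorbs the power \<open>V powr (2 * \<gamma> + 1)\<close> lost in \<open>minimax_at_frequency\<close>, with one
power of \<open>ln n\<close> to spare for the constant \<open>C\<^sup>2\<close>. The amplitude \<open>exp (- \<beta> * w)\<close> is then exactly
\<open>n powr (- \<beta> / (pi + 2 * \<beta>)) * ln n powr (- \<rho>)\<close>.\<close>

lemma eventually_minimax_C:
  fixes s \<gamma> \<beta> L \<epsilon> :: real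
  assumes "0 < s" "0 < \<gamma>" "1 < \<beta>"
    and L: "6 * (sqrt (2 * pi) / s * exp (\<beta>\<^sup>2 / (2 * s\<^sup>2))) < L"
  defines "x \<equiv> exp (- (s\<^sup>2 * (\<gamma> - 1) / 2) + 1)"
    and "\<rho> \<equiv> \<beta> * (2 * \<gamma> + 2) / (pi + 2 * \<beta>)"
  assumes \<epsilon>: "2 * \<epsilon> \<le> normal_density 0 s 1 / x * exp (- (2 * pi * \<beta>))"
  shows "eventually (\<lambda>n. \<forall>q\<in>estimators n. 1 / 8 \<le> (SUP p\<in>time_densities \<inter> mellin_class_C \<beta> \<gamma> L.
          emeasure (sample_law M W n p)
            {X \<in> space (sample_law M W n p).
               \<bar>p x - q X x\<bar> \<ge> \<epsilon> * real n powr (- (\<beta> / (pi + 2 * \<beta>))) * ln (real n) powr (- \<rho>)})) sequentially"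
proof -
  define C where "C = 2 * exp (1 + pi\<^sup>2 / (8 * s\<^sup>2)) * 2 powr (\<gamma> + 1 / 2)"
  define d where "d = 2 * \<gamma> + 2"
  define c where "c = 1 / (pi + 2 * \<beta>)"
  have c: "0 < c" "c \<le> 1 / 5" and c_inv: "c * (pi + 2 * \<beta>) = 1"
    using \<open>1 < \<beta>\<close> pi_gt3 by (auto simp: c_def field_simps add_pos_pos)
  have "0 < d" using \<open>0 < \<gamma>\<close> by (simp add: d_def)
  then have "((\<lambda>l::real. d * ln l / l) \<longlongrightarrow> 0) at_top" by real_asymp
  then have "eventually (\<lambda>l. d * ln l / l < 1) at_top" by (rule order_tendstoD) simp
  then have ev: "eventually (\<lambda>l. d * ln l / l < 1 \<and> l \<ge> max (max 12 (1 / c)) (C\<^sup>2)) at_top"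
    using eventually_ge_at_top by (rule eventually_conj)
  have "eventually (\<lambda>n. d * ln (ln (real n)) / ln (real n) < 1 \<and> ln (real n) \<ge> max (max 12 (1 / c)) (C\<^sup>2)) sequentially"
    using ev ln_real_at_top by (rule eventually_compose_filterlim)
  then show ?thesis using eventually_gt_at_top[of 0]
  proof eventually_elim
    case (elim n)
    define l where "l = ln (real n)"
    have l: "12 \<le> l" "1 / c \<le> l" "C\<^sup>2 \<le> l" and quot: "d * ln l / l < 1" and n: "exp l = real n"
      using elim by (auto simp: l_def)
    have "0 < l" "0 \<le> ln l" using l(1) by auto
    then have dl: "d * ln l \<le> l" using quot by (simp add: divide_less_eq)
    define w where "w = c * (l + d * ln l)"
    obtain V where V: "sin V = 1" "w \<le> V" "V \<le> w + 2 * pi" by (rule exists_frequency)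
    have "1 \<le> w"
    proof -
      have "1 = c * (1 / c)" using c by simp
      also have "\<dots> \<le> c * (l + d * ln l)"
        using c l(2) \<open>0 < d\<close> \<open>0 \<le> ln l\<close> by (intro mult_left_mono add_increasing2) auto
      finally show ?thesis by (simp add: w_def)
    qed
    then have "1 \<le> V" using V by simp
    have "V \<le> l"
    proof -
      have "w \<le> 1 / 5 * (l + l)"
        unfolding w_def using c dl \<open>0 < l\<close> \<open>0 < d\<close> \<open>0 \<le> ln l\<close> by (intro mult_mono add_mono) auto
      moreover have "pi \<le> 3.2" using pi_less_4 pi_approx by simp
      ultimately show ?thesis using V l(1) by simp
    qed
    define K where "K = exp (\<beta> * V)"
    have "1 + \<beta> * V \<le> K" unfolding K_def by (rule exp_ge_add_one_self)
    moreover have "1 * 1 \<le> \<beta> * V" using \<open>1 < \<beta>\<close> \<open>1 \<le> V\<close> by (intro mult_mono) auto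
    ultimately have "2 \<le> K" by simp
    show ?case
    proof
      fix q assume q: "q \<in> estimators n"
      show "1 / 8 \<le> (SUP p\<in>time_densities \<inter> mellin_class_C \<beta> \<gamma> L.
          emeasure (sample_law M W n p)
            {X \<in> space (sample_law M W n p).
               \<bar>p x - q X x\<bar> \<ge> \<epsilon> * real n powr (- (\<beta> / (pi + 2 * \<beta>))) * ln (real n) powr (- \<rho>)})"
        unfolding mellin_class_C_def x_def
      proof (rule minimax_at_frequency[where s = s and K = K and V = V and \<beta> = \<beta>])
        show "exp (\<beta> * \<bar>v\<bar>) \<le> K * exp (\<beta> * \<bar>v + V\<bar>)" for v
        proof -
          have "\<beta> * \<bar>v\<bar> \<le> \<beta> * (V + \<bar>v + V\<bar>)" using \<open>1 < \<beta>\<close> \<open>1 \<le> V\<close> by (intro mult_left_mono) auto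
          then show ?thesis unfolding K_def exp_add[symmetric] distrib_left[symmetric] by simp
        qed
        show "exp (\<beta> * \<bar>v\<bar>) \<le> K * exp (\<beta> * \<bar>v - V\<bar>)" for v
        proof -
          have "\<beta> * \<bar>v\<bar> \<le> \<beta> * (V + \<bar>v - V\<bar>)" using \<open>1 < \<beta>\<close> \<open>1 \<le> V\<close> by (intro mult_left_mono) auto
          then show ?thesis unfolding K_def exp_add[symmetric] distrib_left[symmetric] by simp
        qed
        show "real n * (2 * exp (1 + pi\<^sup>2 / (8 * s\<^sup>2)) * 2 powr (\<gamma> + 1 / 2) * V powr (\<gamma> + 1 / 2)
            * exp (- (pi * V / 2)) / K)\<^sup>2 \<le> 1"
        proof -
          have "exp l * (C * V powr (\<gamma> + 1 / 2) * exp (- (pi * V / 2)) / K)\<^sup>2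
              = C\<^sup>2 * (V powr (\<gamma> + 1 / 2))\<^sup>2 * (exp l * (exp (- (pi * V / 2)) / K)\<^sup>2)"
            by (simp add: power_mult_distrib power_divide)
          also have "(V powr (\<gamma> + 1 / 2))\<^sup>2 = V powr (2 * \<gamma> + 1)"
            by (simp add: power2_eq_square flip: powr_add)
          also have "exp l * (exp (- (pi * V / 2)) / K)\<^sup>2 = exp (l - (pi + 2 * \<beta>) * V)"
            unfolding K_def power2_eq_square exp_diff[symmetric] exp_add[symmetric]
            by (simp add: algebra_simps)
          also have "C\<^sup>2 * V powr (2 * \<gamma> + 1) * exp (l - (pi + 2 * \<beta>) * V)
              \<le> l * l powr (2 * \<gamma> + 1) * exp (- (d * ln l))"
          proof (intro mult_mono powr_mono2)
            have "l + d * ln l = (pi + 2 * \<beta>) * w"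
              using c_inv by (simp add: w_def mult.assoc[symmetric] mult.commute)
            also have "\<dots> \<le> (pi + 2 * \<beta>) * V" using V \<open>1 < \<beta>\<close> by (intro mult_left_mono) auto
            finally show "exp (l - (pi + 2 * \<beta>) * V) \<le> exp (- (d * ln l))" by simp
          qed (use l \<open>V \<le> l\<close> \<open>1 \<le> V\<close> \<open>0 < \<gamma>\<close> in auto)
          also have "\<dots> = l powr 1 * l powr (2 * \<gamma> + 1) * l powr (- d)"
            using \<open>0 < l\<close> by (simp add: powr_def)
          also have "\<dots> = l powr (1 + (2 * \<gamma> + 1) + - d)" by (simp only: powr_add)
          also have "\<dots> = 1" using \<open>0 < l\<close> by (simp add: d_def)
          finally show ?thesis unfolding n C_def by (simp only: mult.assoc)
        qed
        show "2 * (\<epsilon> * real n powr (- (\<beta> / (pi + 2 * \<beta>))) * ln (real n) powr (- \<rho>))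
            \<le> normal_density 0 s 1 / exp (- (s\<^sup>2 * (\<gamma> - 1) / 2) + 1) / K"
        proof -
          have "real n powr (- (\<beta> / (pi + 2 * \<beta>))) * ln (real n) powr (- \<rho>)
              = exp (- (\<beta> * c) * l) * exp (- \<rho> * ln l)"
            using elim \<open>0 < l\<close> by (simp add: powr_def l_def c_def)
          also have "\<dots> = exp (- (\<beta> * w))"
            unfolding exp_add[symmetric] by (simp add: w_def \<rho>_def c_def d_def algebra_simps add_divide_distrib)
          finally have eq: "real n powr (- (\<beta> / (pi + 2 * \<beta>))) * ln (real n) powr (- \<rho>) = exp (- (\<beta> * w))" .
          have "\<beta> * V \<le> \<beta> * (w + 2 * pi)" using V \<open>1 < \<beta>\<close> by (intro mult_left_mono) auto
          then have "exp (- (2 * pi * \<beta>)) * exp (- (\<beta> * w)) \<le> 1 / K"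
            unfolding K_def inverse_eq_divide[symmetric] exp_minus[symmetric] exp_add[symmetric]
            by (simp add: algebra_simps)
          then have "normal_density 0 s 1 / x * (exp (- (2 * pi * \<beta>)) * exp (- (\<beta> * w))) \<le> normal_density 0 s 1 / x * (1 / K)"
            by (rule mult_left_mono) (simp add: x_def)
          moreover have "2 * \<epsilon> * exp (- (\<beta> * w)) \<le> normal_density 0 s 1 / x * exp (- (2 * pi * \<beta>)) * exp (- (\<beta> * w))"
            using \<epsilon> by (rule mult_right_mono) simp
          ultimately show ?thesis
            unfolding mult.assoc eq x_def[symmetric] by simp
        qed
      qed (use assms(1-4) q elim \<open>2 \<le> K\<close> \<open>1 \<le> V\<close> V in auto)
    qed
  qed
qed

text \<open>Any \<open>V \<ge> ln n\<close> makes \<open>n * exp (- pi * V)\<close> decay like a power of \<open>n\<close>, which outweighs every power of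
\<open>ln n\<close>. The rate is therefore given by the amplitude \<open>(1 + V) powr (- \<beta>)\<close> alone.\<close>

lemma eventually_minimax_D:
  fixes s \<gamma> \<beta> L \<epsilon> :: real
  assumes "0 < s" "0 < \<gamma>" "1 < \<beta>"
    and L: "6 * (sqrt (2 * pi) / s * exp (\<beta>\<^sup>2 / (2 * s\<^sup>2))) < L"
  defines "x \<equiv> exp (- (s\<^sup>2 * (\<gamma> - 1) / 2) + 1)"
  assumes \<epsilon>: "2 * \<epsilon> \<le> normal_density 0 s 1 / x * 2 powr (- \<beta>)"
  shows "eventually (\<lambda>n. \<forall>q\<in>estimators n. 1 / 8 \<le> (SUP p\<in>time_densities \<inter> mellin_class_D \<beta> \<gamma> L.
          emeasure (sample_law M W n p)
            {X \<in> space (sample_law M W n p). \<bar>p x - q X x\<bar> \<ge> \<epsilon> * ln (real n) powr (- \<beta>)})) sequentially"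
proof -
  define C where "C = 2 * exp (1 + pi\<^sup>2 / (8 * s\<^sup>2)) * 2 powr (\<gamma> + 1 / 2)"
  have "0 < C" by (simp add: C_def)
  then have "((\<lambda>l::real. C\<^sup>2 * (2 * l) powr (2 * \<gamma> + 1) * exp (- l)) \<longlongrightarrow> 0) at_top" by real_asymp
  then have "eventually (\<lambda>l. C\<^sup>2 * (2 * l) powr (2 * \<gamma> + 1) * exp (- l) < 1) at_top"
    by (rule order_tendstoD) simp
  then have ev: "eventually (\<lambda>l. C\<^sup>2 * (2 * l) powr (2 * \<gamma> + 1) * exp (- l) < 1 \<and> l \<ge> 9) at_top"
    using eventually_ge_at_top by (rule eventually_conj)
  have "eventually (\<lambda>n. C\<^sup>2 * (2 * ln (real n)) powr (2 * \<gamma> + 1) * exp (- ln (real n)) < 1 \<and> ln (real n) \<ge> 9) sequentially"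
    using ev ln_real_at_top by (rule eventually_compose_filterlim)
  then show ?thesis using eventually_gt_at_top[of 0]
  proof eventually_elim
    case (elim n)
    define l where "l = ln (real n)"
    have l: "9 \<le> l" and small: "C\<^sup>2 * (2 * l) powr (2 * \<gamma> + 1) * exp (- l) \<le> 1" and n: "exp l = real n"
      using elim by (auto simp: l_def)
    obtain V where V: "sin V = 1" "l \<le> V" "V \<le> l + 2 * pi" by (rule exists_frequency)
    have "1 \<le> V" "1 + V \<le> 2 * l" using V l pi_less_4 by auto
    define K where "K = (1 + V) powr \<beta>"
    have "2 \<le> K"
    proof -
      have "2 powr 1 \<le> (1 + V) powr 1" using \<open>1 \<le> V\<close> by simp
      also have "\<dots> \<le> K" unfolding K_def using \<open>1 \<le> V\<close> \<open>1 < \<beta>\<close> by (intro powr_mono) auto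
      finally show ?thesis by simp
    qed
    \<comment> \<open>Replaces the weight by a power of \<open>1 + \<bar>v\<bar>\<close>, which is submultiplicative under shifts.\<close>
    have weight: "1 + \<bar>v\<bar> powr \<beta> \<le> (1 + \<bar>v\<bar>) powr \<beta>" for v :: real
    proof (cases "v = 0")
      case False
      have "1 + \<bar>v\<bar> powr \<beta> = 1 * 1 + \<bar>v\<bar> * \<bar>v\<bar> powr (\<beta> - 1)"
        using False by (simp add: powr_diff)
      also have "\<dots> \<le> 1 * (1 + \<bar>v\<bar>) powr (\<beta> - 1) + \<bar>v\<bar> * (1 + \<bar>v\<bar>) powr (\<beta> - 1)"
        using \<open>1 < \<beta>\<close> by (intro add_mono mult_left_mono powr_mono2 ge_one_powr_ge_zero) auto
      also have "\<dots> = (1 + \<bar>v\<bar>) powr \<beta>"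
        unfolding distrib_right[symmetric] by (simp add: powr_mult_base)
      finally show ?thesis .
    qed simp
    have exp_weight: "(1 + \<bar>v\<bar>) powr \<beta> \<le> exp (\<beta> * \<bar>v\<bar>)" for v :: real
      using \<open>1 < \<beta>\<close> ln_add_one_self_le_self[of "\<bar>v\<bar>"] by (simp add: powr_def)
    have shift: "1 + \<bar>v\<bar> powr \<beta> \<le> K * exp (\<beta> * \<bar>w\<bar>)" if "\<bar>v\<bar> \<le> V + \<bar>w\<bar>" for v w :: real
    proof -
      have "1 + \<bar>v\<bar> \<le> (1 + V) * (1 + \<bar>w\<bar>)"
      proof -
        have "0 \<le> V * \<bar>w\<bar>" using \<open>1 \<le> V\<close> by simp
        moreover have "(1 + V) * (1 + \<bar>w\<bar>) = 1 + V + \<bar>w\<bar> + V * \<bar>w\<bar>" by (simp add: algebra_simps)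
        ultimately show ?thesis using that by linarith
      qed
      then have "(1 + \<bar>v\<bar>) powr \<beta> \<le> ((1 + V) * (1 + \<bar>w\<bar>)) powr \<beta>"
        using \<open>1 < \<beta>\<close> by (intro powr_mono2) auto
      also have "\<dots> = K * (1 + \<bar>w\<bar>) powr \<beta>" using \<open>1 \<le> V\<close> by (simp add: K_def powr_mult)
      also have "\<dots> \<le> K * exp (\<beta> * \<bar>w\<bar>)"
        using exp_weight \<open>2 \<le> K\<close> by (intro mult_left_mono) auto
      finally show ?thesis using weight[of v] by linarith
    qed
    show ?case
    proof
      fix q assume q: "q \<in> estimators n"
      show "1 / 8 \<le> (SUP p\<in>time_densities \<inter> mellin_class_D \<beta> \<gamma> L.
          emeasure (sample_law M W n p)
            {X \<in> space (sample_law M W n p). \<bar>p x - q X x\<bar> \<ge> \<epsilon> * ln (real n) powr (- \<beta>)})"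
        unfolding mellin_class_D_def x_def
      proof (rule minimax_at_frequency[where s = s and K = K and V = V and \<beta> = \<beta>])
        show "1 + \<bar>v\<bar> powr \<beta> \<le> exp (\<beta> * \<bar>v\<bar>)" for v
          using weight exp_weight by (rule order_trans)
        show "1 + \<bar>v\<bar> powr \<beta> \<le> K * exp (\<beta> * \<bar>v + V\<bar>)" for v
          using \<open>1 \<le> V\<close> by (intro shift) auto
        show "1 + \<bar>v\<bar> powr \<beta> \<le> K * exp (\<beta> * \<bar>v - V\<bar>)" for v
          using \<open>1 \<le> V\<close> by (intro shift) auto
        show "real n * (2 * exp (1 + pi\<^sup>2 / (8 * s\<^sup>2)) * 2 powr (\<gamma> + 1 / 2) * V powr (\<gamma> + 1 / 2)
            * exp (- (pi * V / 2)) / K)\<^sup>2 \<le> 1"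
        proof -
          have "(C * V powr (\<gamma> + 1 / 2) * exp (- (pi * V / 2)) / K)\<^sup>2
              \<le> (C * V powr (\<gamma> + 1 / 2) * exp (- (pi * V / 2)))\<^sup>2"
          proof (rule power_mono)
            have "0 \<le> C * V powr (\<gamma> + 1 / 2) * exp (- (pi * V / 2))" using \<open>0 < C\<close> by simp
            then show "C * V powr (\<gamma> + 1 / 2) * exp (- (pi * V / 2)) / K \<le> C * V powr (\<gamma> + 1 / 2) * exp (- (pi * V / 2))"
              and "0 \<le> C * V powr (\<gamma> + 1 / 2) * exp (- (pi * V / 2)) / K"
              using \<open>2 \<le> K\<close> divide_left_mono[of 1 K "C * V powr (\<gamma> + 1 / 2) * exp (- (pi * V / 2))"] by simp_all
          qed
          then have "exp l * (C * V powr (\<gamma> + 1 / 2) * exp (- (pi * V / 2)) / K)\<^sup>2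
              \<le> exp l * (C * V powr (\<gamma> + 1 / 2) * exp (- (pi * V / 2)))\<^sup>2"
            by (rule mult_left_mono) simp
          also have "\<dots> = C\<^sup>2 * (V powr (\<gamma> + 1 / 2))\<^sup>2 * (exp l * (exp (- (pi * V / 2)))\<^sup>2)"
            by (simp add: power_mult_distrib)
          also have "(V powr (\<gamma> + 1 / 2))\<^sup>2 = V powr (2 * \<gamma> + 1)"
            by (simp add: power2_eq_square flip: powr_add)
          also have "exp l * (exp (- (pi * V / 2)))\<^sup>2 = exp (l - pi * V)"
            by (simp add: power2_eq_square exp_diff exp_minus field_simps flip: exp_add)
          also have "C\<^sup>2 * V powr (2 * \<gamma> + 1) * exp (l - pi * V) \<le> C\<^sup>2 * (2 * l) powr (2 * \<gamma> + 1) * exp (- l)"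
          proof (intro mult_mono powr_mono2)
            have "2 * l \<le> pi * V" using V l pi_ge_two by (intro mult_mono) auto
            then show "exp (l - pi * V) \<le> exp (- l)" by simp
          qed (use l \<open>1 + V \<le> 2 * l\<close> \<open>1 \<le> V\<close> \<open>0 < \<gamma>\<close> in auto)
          also note small
          finally show ?thesis unfolding n C_def by (simp only: mult.assoc)
        qed
        show "2 * (\<epsilon> * ln (real n) powr (- \<beta>)) \<le> normal_density 0 s 1 / exp (- (s\<^sup>2 * (\<gamma> - 1) / 2) + 1) / K"
        proof -
          have "K \<le> (2 * l) powr \<beta>"
            unfolding K_def using \<open>1 + V \<le> 2 * l\<close> \<open>1 \<le> V\<close> \<open>1 < \<beta>\<close> by (intro powr_mono2) auto
          then have "1 / (2 * l) powr \<beta> \<le> 1 / K" using \<open>2 \<le> K\<close> l by (intro divide_left_mono mult_pos_pos) auto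
          moreover have "2 powr (- \<beta>) * l powr (- \<beta>) = 1 / (2 * l) powr \<beta>"
            using l by (simp add: powr_mult powr_minus field_simps)
          ultimately have "normal_density 0 s 1 / x * (2 powr (- \<beta>) * l powr (- \<beta>)) \<le> normal_density 0 s 1 / x * (1 / K)"
            by (intro mult_left_mono) (auto simp: x_def)
          moreover have "2 * \<epsilon> * l powr (- \<beta>) \<le> normal_density 0 s 1 / x * 2 powr (- \<beta>) * l powr (- \<beta>)"
            using \<epsilon> by (rule mult_right_mono) simp
          ultimately show ?thesis unfolding l_def[symmetric] x_def[symmetric] by simp
        qed
      qed (use assms(1-4) q elim \<open>2 \<le> K\<close> \<open>1 \<le> V\<close> V in auto)
    qed
  qed
qed

end

lemma liminf_pos_of_eventually:
  fixes f :: "nat \<Rightarrow> 'c \<Rightarrow> ennreal"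
  assumes "eventually (\<lambda>n. \<forall>q\<in>E n. 1 / 8 \<le> f n q) sequentially"
  shows "liminf (\<lambda>n. INF q\<in>E n. f n q) > 0"
proof -
  have "1 / 8 \<le> liminf (\<lambda>n. INF q\<in>E n. f n q)"
    using assms by (intro Liminf_bounded) (auto elim!: eventually_mono intro: INF_greatest)
  moreover have "0 < (1 / 8 :: ennreal)" by (simp add: ennreal_zero_less_divide)
  ultimately show ?thesis by (rule less_le_trans[rotated])
qed

theorem theorem2p8:
  fixes M :: "'a measure" and W :: "real \<Rightarrow> 'a \<Rightarrow> real" and \<beta> \<gamma> L :: real
  assumes "standard_brownian_motion M W"
    and "\<beta> > 1" and "\<gamma> > 0" and "L > 0"
  shows "\<exists>\<epsilon>>0. \<exists>x>0.
    (\<exists>\<rho>>0. liminf (\<lambda>n.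
        INF q\<in>estimators n. SUP p\<in>time_densities \<inter> mellin_class_C \<beta> \<gamma> L.
          emeasure (sample_law M W n p)
            {X \<in> space (sample_law M W n p).
               \<bar>p x - q X x\<bar> \<ge> \<epsilon> * real n powr (- (\<beta> / (pi + 2 * \<beta>))) * ln (real n) powr (- \<rho>)})
      > 0) \<and>
    liminf (\<lambda>n.
        INF q\<in>estimators n. SUP p\<in>time_densities \<inter> mellin_class_D \<beta> \<gamma> L.
          emeasure (sample_law M W n p)
            {X \<in> space (sample_law M W n p).
               \<bar>p x - q X x\<bar> \<ge> \<epsilon> * ln (real n) powr (- \<beta>)})
      > 0"
proof -
  interpret standard_brownian_motion M W by fact
  define A where "A = 6 * (sqrt (2 * pi) * exp (\<beta>\<^sup>2 / 2))"
  have "0 < A" by (simp add: A_def)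
  \<comment> \<open>A wide Gaussian brings the Mellin integral below \<open>L\<close>.\<close>
  define s where "s = max 1 (A / L + 1)"
  have s: "1 \<le> s" "A / L < s" by (auto simp: s_def)
  have L: "6 * (sqrt (2 * pi) / s * exp (\<beta>\<^sup>2 / (2 * s\<^sup>2))) < L"
  proof -
    have "\<beta>\<^sup>2 / (2 * s\<^sup>2) \<le> \<beta>\<^sup>2 / (2 * 1)" using s(1) by (intro divide_left_mono) auto
    then have "6 * (sqrt (2 * pi) / s * exp (\<beta>\<^sup>2 / (2 * s\<^sup>2))) \<le> 6 * (sqrt (2 * pi) / s * exp (\<beta>\<^sup>2 / 2))"
      using s(1) by (intro mult_left_mono) auto
    also have "\<dots> = A / s" by (simp add: A_def)
    also have "\<dots> < L" using s \<open>L > 0\<close> by (simp add: field_simps)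
    finally show ?thesis .
  qed
  define x where "x = exp (- (s\<^sup>2 * (\<gamma> - 1) / 2) + 1)"
  define D where "D = normal_density 0 s 1 / x"
  have "0 < D" using s by (simp add: D_def x_def normal_density_pos)
  define \<epsilon> where "\<epsilon> = D * min (exp (- (2 * pi * \<beta>))) (2 powr (- \<beta>)) / 2"
  have "0 < \<epsilon>" using \<open>0 < D\<close> by (simp add: \<epsilon>_def)
  have \<epsilon>: "2 * \<epsilon> \<le> D * exp (- (2 * pi * \<beta>))" "2 * \<epsilon> \<le> D * 2 powr (- \<beta>)"
    using \<open>0 < D\<close> by (auto simp: \<epsilon>_def)
  have "0 < s" using s by simp
  let ?\<rho> = "\<beta> * (2 * \<gamma> + 2) / (pi + 2 * \<beta>)"
  show ?thesis
  proof (rule exI[of _ \<epsilon>], rule conjI, goal_cases)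
    case 2
    show ?case
    proof (rule exI[of _ x], intro conjI exI[of _ ?\<rho>] liminf_pos_of_eventually)
    show "0 < x" by (simp add: x_def)
    show "0 < ?\<rho>" using assms(2,3) by (intro divide_pos_pos mult_pos_pos add_pos_pos) auto
    show "eventually (\<lambda>n. \<forall>q\<in>estimators n. 1 / 8 \<le> (SUP p\<in>time_densities \<inter> mellin_class_C \<beta> \<gamma> L.
          emeasure (sample_law M W n p)
            {X \<in> space (sample_law M W n p).
               \<bar>p x - q X x\<bar> \<ge> \<epsilon> * real n powr (- (\<beta> / (pi + 2 * \<beta>))) * ln (real n) powr (- ?\<rho>)})) sequentially"
      using eventually_minimax_C[OF \<open>0 < s\<close> assms(3,2) L] \<epsilon>(1) unfolding x_def D_def by blast
    show "eventually (\<lambda>n. \<forall>q\<in>estimators n. 1 / 8 \<le> (SUP p\<in>time_densities \<inter> mellin_class_D \<beta> \<gamma> L.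
          emeasure (sample_law M W n p)
            {X \<in> space (sample_law M W n p). \<bar>p x - q X x\<bar> \<ge> \<epsilon> * ln (real n) powr (- \<beta>)})) sequentially"
      using eventually_minimax_D[OF \<open>0 < s\<close> assms(3,2) L] \<epsilon>(2) unfolding x_def D_def by blast
    qed
  qed (rule \<open>0 < \<epsilon>\<close>)
qed

end
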